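(* Let $f:\mathbb{R}^2\to\mathbb{R}$ be a non-constant polynomial function, with the origin in $\Omega(f)$. Let $\gamma$ and $\delta$ be two consecutive Milnor arcs (in the counterclockwise order of arcs) such that they have either different points at infinity, or the same point at infinity $p\in\mathcal{L}_f$ but are tangent to different semi-lines at $p$. Let $\mathcal{C}_\gamma$ and $\mathcal{C}_\delta$ be their respective clusters. Then the corresponding fibre components $\alpha_t(\mathcal{C}_\gamma)$ and $\alpha_t(\mathcal{C}_\delta)$ cannot both split.
   Context: $\mathbb{R}^2\subset\mathbb{P}^2$ via $(x,y)\mapsto[x:y:1]$, $L^\infty$ is the line at infinity, and $\mathcal{L}_f\subset L^\infty$ is the finite set of all points belonging to $\overline{f^{-1}(t)}\cap L^\infty$ for some $t\in\mathbb{R}$. Semi-lines at $p$ are half-lines with origin $p$ in an affine chart of $\mathbb{P}^2$ at $p$. Milnor arcs. For $a\in\mathbb{R}^2$, $\rho_a(x,y)=(x-a_1)^2+(y-a_2)^2$ and $M_a(f)$ is the zero set of the Jacobian determinant of $(f,\rho_a)$, with reduced structure. $\Omega(f)\subset\mathbb{R}^2$ is a dense set of points $a$ such that $M_a(f)$ has dimension 1 and the following description holds at $a$; for $a=0$ write $M(f)$. For all large enough $R$, with $D_R$ the closed disk of radius $R$ centred at the origin, $M(f)\setminus(D_R\cup\operatorname{Sing} f)$ is a finite disjoint union of connected 1-manifolds, the *Milnor arcs*; each is parametrised by $\gamma:]R,+\infty[\to\mathbb{R}^2$ with distance to the origin strictly monotone and tending to infinity, and $f\circ\gamma$ either strictly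 increasing with limit $\lambda\in\mathbb{R}\cup\{+\infty\}$ (written $f_{|\gamma}\nearrow\lambda$), or strictly decreasing with limit $\lambda\in\mathbb{R}\cup\{-\infty\}$ (written $f_{|\gamma}\searrow\lambda$). Each Milnor arc has a unique point at infinity in $\overline\gamma\cap L^\infty$. Clusters. Milnor arcs are ordered cyclically by the counterclockwise order of their intersection points with a large circle centred at the origin; two arcs are consecutive if one is the immediate successor of the other in this order. An *increasing cluster* at $\lambda\in\mathbb{R}\cup\{+\infty\}$ is a sequence of consecutive Milnor arcs $\gamma_k,\dots,\gamma_{k+l}$, $l\ge0$, such that $f_{|\gamma_i}\nearrow\lambda$ holds for all $i=k,\dots,k+l$ and fails for the antecedent of $\gamma_k$ and for the successor of $\gamma_{k+l}$. A *decreasing cluster* at $\lambda\in\mathbb{R}\cup\{-\infty\}$ is defined similarly with $\searrow$. For a cluster $\mathcal{C}$ at $\lambda$ and $t$ close enough to $\lambda$ (on the side from which $f$ approaches $\lambda$ along the arcs), $\alpha_t(\mathcal{C})$ denotes the unique connected component of $f^{-1}(t)\setminus D_R$ which intersects all the Milnor arcs of $\mathcal{C}$. Splitting. The limit set $\lim_{t\to\lambda}M_t$ of a family of sets $M_t\subset\mathbb{R}^2$ is the set of limits of convergent sequences $x_k\in M_{t_k}$ with $t_k\to\lambda$. For a cluster $\mathcal{C}$ at $\lambda\in\mathbb{R}$ (where $\operatorname{Sing} f^{-1}(\lambda)$ is compact), the component $\alpha_t(\mathcal{C})$ *splits* (at infinity, as $t\to\lambda$) if there is a continuous family of analytic paths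 $\phi_t:[0,1]\to\alpha_t(\mathcal{C})$, for $t$ near $\lambda$ on the relevant side, such that $\operatorname{Im}\phi_t\cap M(f)\ne\emptyset$, $\|q_t\|\to\infty$ for any $q_t\in\operatorname{Im}\phi_t\cap M(f)$ as $t\to\lambda$, and the limit set $\lim_{t\to\lambda}\operatorname{Im}\phi_t$ is not connected. *)

theory Defs
  imports "HOL-Analysis.Analysis"
begin

section \<open>The real projective plane\<close>

definition proportional :: "real^3 \<Rightarrow> real^3 \<Rightarrow> bool" where
  "proportional u v \<longleftrightarrow> u \<noteq> 0 \<and> v \<noteq> 0 \<and> (\<exists>c. c \<noteq> 0 \<and> u = c *\<^sub>R v)"

quotient_type proj_plane = "real^3" / partial: proportional
  morphisms rep_proj homogeneous
proof (rule part_equivpI)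
  show "\<exists>v. proportional v v"
    by (intro exI[of _ "axis 1 1"]) (auto simp: proportional_def axis_eq_0_iff intro!: exI[of _ 1])
  show "symp proportional"
  proof (rule sympI)
    fix u v assume "proportional u v"
    then obtain c where "u \<noteq> 0" "v \<noteq> 0" "c \<noteq> 0" "u = c *\<^sub>R v"
      by (auto simp: proportional_def)
    then show "proportional v u"
      by (auto simp: proportional_def intro!: exI[of _ "inverse c"])
  qed
  show "transp proportional"
  proof (rule transpI)
    fix u v w assume "proportional u v" "proportional v w"
    then obtain c d where "u \<noteq> 0" "w \<noteq> 0" "c \<noteq> 0" "d \<noteq> 0" "u = c *\<^sub>R v" "v = d *\<^sub>R w"
      by (auto simp: proportional_def)
    then show "proportional u w"
      by (auto simp: proportional_def intro!: exI[of _ "c * d"])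
  qed
qed

text \<open>The quotient topology of \<open>\<real>\<^sup>3 - {0}\<close>; \<open>homogeneous v\<close> is meaningful for \<open>v \<noteq> 0\<close> only.\<close>

instantiation proj_plane :: topological_space
begin

definition open_proj_plane :: "proj_plane set \<Rightarrow> bool" where
  "open_proj_plane U \<longleftrightarrow> open {v. v \<noteq> 0 \<and> homogeneous v \<in> U}"

instance
proof
  have "{v::real^3. v \<noteq> 0 \<and> homogeneous v \<in> UNIV} = - {0}"
    by auto
  then show "open (UNIV :: proj_plane set)"
    unfolding open_proj_plane_def by (simp add: open_Compl)
next
  fix S T :: "proj_plane set"
  assume "open S" "open T"
  moreover have "{v. v \<noteq> 0 \<and> homogeneous v \<in> S \<inter> T} =
      {v. v \<noteq> 0 \<and> homogeneous v \<in> S} \<inter> {v. v \<noteq> 0 \<and> homogeneous v \<in> T}"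
    by auto
  ultimately show "open (S \<inter> T)"
    unfolding open_proj_plane_def by auto
next
  fix K :: "proj_plane set set"
  assume "\<forall>S\<in>K. open S"
  moreover have "{v. v \<noteq> 0 \<and> homogeneous v \<in> \<Union>K} =
      (\<Union>S\<in>K. {v. v \<noteq> 0 \<and> homogeneous v \<in> S})"
    by auto
  ultimately show "open (\<Union>K)"
    unfolding open_proj_plane_def by auto
qed

end

definition proj_embed :: "real^2 \<Rightarrow> proj_plane" where
  "proj_embed x = homogeneous (vector [x$1, x$2, 1])"

definition line_at_infinity :: "proj_plane set" where
  "line_at_infinity = {homogeneous (vector [u, v, 0]) | u v. u \<noteq> 0 \<or> v \<noteq> 0}"

text \<open>The affine charts of the plane are the maps \<open>[v] \<mapsto> (y\<^sub>1/y\<^sub>3, y\<^sub>2/y\<^sub>3)\<close>, \<open>y = A v\<close>,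
  on \<open>{y\<^sub>3 \<noteq> 0}\<close>, for the invertible matrices \<open>A\<close>.\<close>

lift_definition affine_chart :: "real^3^3 \<Rightarrow> proj_plane \<Rightarrow> real^2" is
  "\<lambda>A v. vector [(A *v v)$1 / (A *v v)$3, (A *v v)$2 / (A *v v)$3]"
  by (auto simp: proportional_def scaleR_matrix_vector_assoc[symmetric] matrix_vector_mult_scaleR)

lift_definition in_chart_domain :: "real^3^3 \<Rightarrow> proj_plane \<Rightarrow> bool" is
  "\<lambda>A v. (A *v v)$3 \<noteq> 0"
  by (auto simp: proportional_def matrix_vector_mult_scaleR)

definition affine_chart_at :: "real^3^3 \<Rightarrow> proj_plane \<Rightarrow> bool" where
  "affine_chart_at A p \<longleftrightarrow> invertible A \<and> in_chart_domain A p"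

definition tangent_to_semi_line ::
    "real^3^3 \<Rightarrow> proj_plane \<Rightarrow> (real^2) set \<Rightarrow> (real^2) set \<Rightarrow> bool" where
  "tangent_to_semi_line A p G H \<longleftrightarrow>
     (\<exists>u. norm u = 1 \<and> H = {affine_chart A p + t *\<^sub>R u | t. t \<ge> 0} \<and>
        ((\<lambda>q. sgn (affine_chart A q - affine_chart A p)) \<longlongrightarrow> u) (at p within proj_embed ` G))"

text \<open>Changes of affine charts preserve tangency of semi-lines at \<open>p\<close>, so the choice of the
  chart is immaterial.\<close>

definition tangent_to_different_semi_lines ::
    "proj_plane \<Rightarrow> (real^2) set \<Rightarrow> (real^2) set \<Rightarrow> bool" where
  "tangent_to_different_semi_lines p G G' \<longleftrightarrow>
     (\<exists>A H H'. affine_chart_at A p \<and> tangent_to_semi_line A p G H \<and>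
        tangent_to_semi_line A p G' H' \<and> H \<noteq> H')"

definition points_at_infinity :: "(real^2) set \<Rightarrow> proj_plane set" where
  "points_at_infinity S = closure (proj_embed ` S) \<inter> line_at_infinity"

definition point_at_infinity :: "(real^2) set \<Rightarrow> proj_plane" where
  "point_at_infinity S = (THE p. p \<in> points_at_infinity S)"

definition fibre_points_at_infinity :: "(real^2 \<Rightarrow> real) \<Rightarrow> proj_plane set" where
  "fibre_points_at_infinity f = (\<Union>t. points_at_infinity (f -` {t}))"


section \<open>Dimension of real algebraic sets\<close>

definition algebraic_set :: "(real^2) set \<Rightarrow> bool" where
  "algebraic_set S \<longleftrightarrow>
     (\<exists>P. (\<forall>p\<in>P. real_polynomial_function p) \<and> S = {x. \<forall>p\<in>P. p x = 0})"

definition irreducible_algebraic_set :: "(real^2) set \<Rightarrow> bool" where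
  "irreducible_algebraic_set S \<longleftrightarrow> algebraic_set S \<and> S \<noteq> {} \<and>
     (\<forall>A B. algebraic_set A \<and> algebraic_set B \<and> S = A \<union> B \<longrightarrow> S = A \<or> S = B)"

definition algebraic_dim :: "(real^2) set \<Rightarrow> enat" where
  "algebraic_dim S = Sup {enat n | n. \<exists>Z. (\<forall>i\<le>n. irreducible_algebraic_set (Z i) \<and> Z i \<subseteq> S) \<and>
     (\<forall>i<n. Z i \<subset> Z (Suc i))}"


section \<open>Milnor sets and Milnor arcs\<close>

definition rho :: "real^2 \<Rightarrow> real^2 \<Rightarrow> real" where
  "rho a x = (x$1 - a$1)\<^sup>2 + (x$2 - a$2)\<^sup>2"

definition sing :: "(real^2 \<Rightarrow> real) \<Rightarrow> (real^2) set" where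
  "sing f = {x. (f has_derivative (\<lambda>_. 0)) (at x)}"

definition milnor_set :: "(real^2 \<Rightarrow> real) \<Rightarrow> real^2 \<Rightarrow> (real^2) set" where
  "milnor_set f a = {x. det (jacobian (\<lambda>y. vector [f y, rho a y] :: real^2) (at x)) = 0}"

definition milnor_arcs :: "(real^2 \<Rightarrow> real) \<Rightarrow> real^2 \<Rightarrow> real \<Rightarrow> (real^2) set set" where
  "milnor_arcs f a R = components (milnor_set f a - (cball a R \<union> sing f))"

definition parametrises :: "real^2 \<Rightarrow> real \<Rightarrow> (real^2) set \<Rightarrow> (real \<Rightarrow> real^2) \<Rightarrow> bool" where
  "parametrises a R G c \<longleftrightarrow> (\<exists>d. homeomorphism {R<..} G c d) \<and>
     strict_mono_on {R<..} (\<lambda>s. dist a (c s)) \<and> filterlim (\<lambda>s. dist a (c s)) at_top at_top"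

definition increases_to ::
    "(real^2 \<Rightarrow> real) \<Rightarrow> real^2 \<Rightarrow> real \<Rightarrow> (real^2) set \<Rightarrow> ereal \<Rightarrow> bool" where
  "increases_to f a R G l \<longleftrightarrow> (\<exists>c. parametrises a R G c \<and>
     strict_mono_on {R<..} (f \<circ> c) \<and> ((\<lambda>s. ereal (f (c s))) \<longlongrightarrow> l) at_top)"

definition decreases_to ::
    "(real^2 \<Rightarrow> real) \<Rightarrow> real^2 \<Rightarrow> real \<Rightarrow> (real^2) set \<Rightarrow> ereal \<Rightarrow> bool" where
  "decreases_to f a R G l \<longleftrightarrow> (\<exists>c. parametrises a R G c \<and>
     strict_antimono_on {R<..} (f \<circ> c) \<and> ((\<lambda>s. ereal (f (c s))) \<longlongrightarrow> l) at_top)"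

text \<open>The set of all centres at which the structure of the Milnor set at infinity is generic.\<close>

definition Omega :: "(real^2 \<Rightarrow> real) \<Rightarrow> (real^2) set" where
  "Omega f = {a. algebraic_dim (milnor_set f a) = 1 \<and>
     (\<forall>\<^sub>F R in at_top. finite (milnor_arcs f a R) \<and>
        (\<forall>G\<in>milnor_arcs f a R. (\<exists>l. increases_to f a R G l \<or> decreases_to f a R G l) \<and>
           (\<exists>!p. p \<in> points_at_infinity G)))}"


section \<open>Cyclic order and clusters\<close>

definition rotate_ccw :: "real \<Rightarrow> real^2 \<Rightarrow> real^2" where
  "rotate_ccw \<theta> x = vector [cos \<theta> * x$1 - sin \<theta> * x$2, sin \<theta> * x$1 + cos \<theta> * x$2]"

text \<open>\<open>G'\<close> is the first Milnor arc met after \<open>G\<close> on every large circle run through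
  counterclockwise; the angle \<open>2 * pi\<close> makes a single arc its own successor.\<close>

definition immediate_successor ::
    "(real^2 \<Rightarrow> real) \<Rightarrow> real \<Rightarrow> (real^2) set \<Rightarrow> (real^2) set \<Rightarrow> bool" where
  "immediate_successor f R G G' \<longleftrightarrow> G \<in> milnor_arcs f 0 R \<and> G' \<in> milnor_arcs f 0 R \<and>
     (\<forall>\<^sub>F r in at_top. \<exists>x\<in>G. norm x = r \<and> (\<exists>\<theta>. 0 < \<theta> \<and> \<theta> \<le> 2 * pi \<and> rotate_ccw \<theta> x \<in> G' \<and>
        (\<forall>\<psi>. 0 < \<psi> \<and> \<psi> < \<theta> \<longrightarrow> rotate_ccw \<psi> x \<notin> \<Union>(milnor_arcs f 0 R))))"

definition consecutive ::
    "(real^2 \<Rightarrow> real) \<Rightarrow> real \<Rightarrow> (real^2) set \<Rightarrow> (real^2) set \<Rightarrow> bool" where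
  "consecutive f R G G' \<longleftrightarrow> immediate_successor f R G G' \<or> immediate_successor f R G' G"

definition maximal_run ::
    "(real^2 \<Rightarrow> real) \<Rightarrow> real \<Rightarrow> ((real^2) set \<Rightarrow> bool) \<Rightarrow> (real^2) set list \<Rightarrow> bool" where
  "maximal_run f R P C \<longleftrightarrow> C \<noteq> [] \<and> set C \<subseteq> milnor_arcs f 0 R \<and>
     (\<forall>i. Suc i < length C \<longrightarrow> immediate_successor f R (C ! i) (C ! Suc i)) \<and>
     (\<forall>G\<in>set C. P G) \<and>
     (\<forall>G. immediate_successor f R G (hd C) \<longrightarrow> \<not> P G) \<and>
     (\<forall>G. immediate_successor f R (last C) G \<longrightarrow> \<not> P G)"

definition increasing_cluster ::
    "(real^2 \<Rightarrow> real) \<Rightarrow> real \<Rightarrow> (real^2) set list \<Rightarrow> ereal \<Rightarrow> bool" where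
  "increasing_cluster f R C l \<longleftrightarrow> maximal_run f R (\<lambda>G. increases_to f 0 R G l) C"

definition decreasing_cluster ::
    "(real^2 \<Rightarrow> real) \<Rightarrow> real \<Rightarrow> (real^2) set list \<Rightarrow> ereal \<Rightarrow> bool" where
  "decreasing_cluster f R C l \<longleftrightarrow> maximal_run f R (\<lambda>G. decreases_to f 0 R G l) C"

definition cluster_of ::
    "(real^2 \<Rightarrow> real) \<Rightarrow> real \<Rightarrow> (real^2) set \<Rightarrow> (real^2) set list \<Rightarrow> bool" where
  "cluster_of f R G C \<longleftrightarrow>
     G \<in> set C \<and> (\<exists>l. increasing_cluster f R C l \<or> decreasing_cluster f R C l)"


section \<open>Splitting of fibre components\<close>

text \<open>\<open>A\<close> is the component \<open>\<alpha>\<^sub>t(C)\<close> of the fibre over \<open>t\<close>. It is unique for \<open>t\<close> close to the limit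
  value, because \<open>f\<close> takes the value \<open>t\<close> at most once on a Milnor arc.\<close>

definition is_alpha ::
    "(real^2 \<Rightarrow> real) \<Rightarrow> real \<Rightarrow> (real^2) set list \<Rightarrow> real \<Rightarrow> (real^2) set \<Rightarrow> bool" where
  "is_alpha f R C t A \<longleftrightarrow>
     A \<in> components (f -` {t} - cball 0 R) \<and> (\<forall>G\<in>set C. A \<inter> G \<noteq> {})"

definition limit_set :: "real filter \<Rightarrow> (real \<Rightarrow> (real^2) set) \<Rightarrow> (real^2) set" where
  "limit_set F M = {x. \<exists>t y. filterlim t F sequentially \<and> (\<forall>k. y k \<in> M (t k)) \<and> y \<longlonglongrightarrow> x}"

definition analytic_path :: "(real \<Rightarrow> real^2) \<Rightarrow> bool" where
  "analytic_path c \<longleftrightarrow> (\<forall>s\<in>{0..1}. \<exists>r>0. \<exists>b. \<forall>u\<in>{0..1}. \<bar>u - s\<bar> < r \<longrightarrow>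
     (\<lambda>n. (u - s) ^ n *\<^sub>R b n) sums c u)"

text \<open>The filter \<open>F\<close> is \<open>at_left l\<close> or \<open>at_right l\<close>.\<close>

definition splits_along ::
    "(real^2 \<Rightarrow> real) \<Rightarrow> real \<Rightarrow> (real^2) set list \<Rightarrow> real filter \<Rightarrow> bool" where
  "splits_along f R C F \<longleftrightarrow> (\<exists>T \<phi>. (\<forall>\<^sub>F t in F. t \<in> T) \<and>
     continuous_on (T \<times> {0..1}) (\<lambda>(t, s). \<phi> t s) \<and>
     (\<forall>t\<in>T. analytic_path (\<phi> t) \<and> (\<exists>A. is_alpha f R C t A \<and> \<phi> t ` {0..1} \<subseteq> A) \<and>
        \<phi> t ` {0..1} \<inter> milnor_set f 0 \<noteq> {}) \<and>
     (\<forall>q. (\<forall>t\<in>T. q t \<in> \<phi> t ` {0..1} \<inter> milnor_set f 0) \<longrightarrow> filterlim (\<lambda>t. norm (q t)) at_top F) \<and>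
     \<not> connected (limit_set F (\<lambda>t. \<phi> t ` {0..1})))"

text \<open>Splitting is a notion for clusters at a finite value \<open>l\<close> with compact singular locus of the
  fibre over \<open>l\<close>.\<close>

definition splits :: "(real^2 \<Rightarrow> real) \<Rightarrow> real \<Rightarrow> (real^2) set list \<Rightarrow> bool" where
  "splits f R C \<longleftrightarrow> (\<exists>l::real. compact (sing f \<inter> f -` {l}) \<and>
     (increasing_cluster f R C (ereal l) \<and> splits_along f R C (at_left l) \<or>
      decreasing_cluster f R C (ereal l) \<and> splits_along f R C (at_right l)))"

end

theory Submission
  imports Defs
begin

text \<open>
  A component \<open>\<alpha>\<^sub>t(C)\<close> can split only if the cluster \<open>C\<close> lies at a finite value, so if both components
  split then \<open>f\<close> is bounded along \<open>\<gamma>\<close> and along \<open>\<delta>\<close>.  Two consecutive arcs that are separated at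
  infinity cannot both have this property.

  Let \<open>S\<close> be the sector swept counterclockwise from one arc to its successor; no Milnor arc lies
  inside \<open>S\<close>.  Then \<open>f\<close> is bounded on \<open>S\<close> (\<open>bounded_above_on_sector\<close>).  Critical points of the
  restriction of \<open>f\<close> to a circle lie in the Milnor set; inside \<open>S\<close> they are therefore singular
  points of \<open>f\<close>.  The singular locus may be unbounded in \<open>S\<close>, and \<open>f\<close> need not be monotone on a
  circular arc that crosses it; instead of comparing values along such arcs, one maximises
  \<open>f(z) - \<epsilon> |z|\<close> over the part of \<open>S\<close> between two circles.  A maximum that is off the two arcs and
  off the inner circle is critical along its circle, hence a singular point of \<open>f\<close>, and then moving
  radially inwards increases \<open>f(z) - \<epsilon> |z|\<close>.  So the maximum is attained on the arcs or on the inner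
  circle, and \<open>\<epsilon> \<rightarrow> 0\<close> gives the bound.

  A polynomial that is bounded on a half-line is constant on the whole line, so \<open>f\<close> is constant on
  every line with a half-line contained in \<open>S\<close>.  As an arc has a single point at infinity, it has an
  asymptotic direction.  If the opening angle of \<open>S\<close> stays away from zero, \<open>S\<close> contains a half-line
  from the origin in every direction of an open set, and \<open>f\<close> is constant
  (\<open>wide_sector_imp_constant\<close>).  This covers two arcs with different directions, including
  opposite ones with the same point at infinity.

  If both arcs have direction \<open>v\<close>, write them as \<open>(X + iY) v\<close>.  The semi-line tangent to an arc at
  infinity determines the limit of the height \<open>Y\<close> in \<open>[-\<infinity>, \<infinity>]\<close>
  (\<open>semi_line_tangent_slope\<close>, \<open>slope_tangents_separate\<close>), so different semi-lines give
  heights separated by an open interval.  Either \<open>S\<close> goes the long way round the origin and is wide,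
  or \<open>S\<close> contains a half-line parallel to \<open>v\<close> at each height of that interval.  In the
  second case \<open>f\<close> is invariant under translation by \<open>v\<close>, the Milnor set off the singular locus
  lies on the line through the origin orthogonal to \<open>v\<close>, and no arc is asymptotic to \<open>v\<close>.
\<close>

section \<open>Real polynomials on lines\<close>

lemma bounded_real_polynomial_half_line:
  fixes q :: "real \<Rightarrow> real"
  assumes "real_polynomial_function q" and "\<forall>\<^sub>F s in at_top. \<bar>q s\<bar> \<le> B"
  shows "q s = q t"
proof -
  obtain a n where q: "q = (\<lambda>x. \<Sum>i\<le>n. a i * x ^ i)"
    using real_polynomial_function_imp_sum[OF assms(1)] by blast
  have "\<not> (\<exists>k. k \<noteq> 0 \<and> k \<le> n \<and> a k \<noteq> 0)"
  proof
    assume "\<exists>k. k \<noteq> 0 \<and> k \<le> n \<and> a k \<noteq> 0"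
    then have "\<forall>\<^sub>F x in at_infinity. norm (q x) \<ge> B + 1"
      unfolding q by (rule polyfun_extremal)
    then have "\<forall>\<^sub>F x in at_top. norm (q x) \<ge> B + 1"
      by (meson at_top_le_at_infinity filter_leD)
    with assms(2) have "\<forall>\<^sub>F x::real in at_top. False"
      by eventually_elim auto
    then show False by simp
  qed
  then have "a i * x ^ i = (if i = 0 then a 0 else 0)" if "i \<le> n" for i x
    using that by auto
  then have "q x = a 0" for x
    unfolding q by simp
  then show ?thesis by simp
qed

lemma real_polynomial_vanishing_interval:
  fixes q :: "real \<Rightarrow> real"
  assumes "real_polynomial_function q" and "a < b" and "\<And>s. a < s \<Longrightarrow> s < b \<Longrightarrow> q s = 0"
  shows "q s = 0"
proof -
  obtain c n where q: "q = (\<lambda>x. \<Sum>i\<le>n. c i * x ^ i)"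
    using real_polynomial_function_imp_sum[OF assms(1)] by blast
  have "{a<..<b} \<subseteq> {x. q x = 0}"
    using assms(3) by auto
  then have "infinite {x. q x = 0}"
    using assms(2) infinite_Ioo infinite_super by blast
  then have "\<forall>i\<le>n. c i = 0"
    unfolding q using polyfun_finite_roots[of c n] by blast
  then show ?thesis by (simp add: q)
qed

lemma real_polynomial_function_line:
  assumes "real_polynomial_function F"
  shows "real_polynomial_function (\<lambda>s::real. F (p + s *\<^sub>R u))"
proof -
  have "polynomial_function (\<lambda>s::real. p + s *\<^sub>R u)"
    by (intro polynomial_function_add polynomial_function_const polynomial_function_bounded_linear
        bounded_linear_scaleR_left)
  from real_polynomial_function_compose[OF this assms] show ?thesis
    by (simp add: o_def)
qed

text \<open>
  Every point is joined by a line to the centre of the open set, and the one-variable case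
  applies along that line.
\<close>
lemma real_polynomial_vanishing_open_set:
  fixes F :: "complex \<Rightarrow> real"
  assumes "real_polynomial_function F" and "\<forall>\<^sub>F z in nhds z0. F z = k"
  shows "F z = k"
proof -
  have poly: "real_polynomial_function (\<lambda>t. F (z0 + t *\<^sub>R (z - z0)) - k)"
    by (intro real_polynomial_function_diff real_polynomial_function.intros(2)
        real_polynomial_function_line assms(1))
  have "((\<lambda>t::real. z0 + t *\<^sub>R (z - z0)) \<longlongrightarrow> z0) (at_right 0)"
    by (auto intro!: tendsto_eq_intros)
  from eventually_compose_filterlim[OF assms(2) this]
  have "\<forall>\<^sub>F t in at_right 0. F (z0 + t *\<^sub>R (z - z0)) = k" .
  then obtain b where "b > 0" and b: "\<forall>t>0. t < b \<longrightarrow> F (z0 + t *\<^sub>R (z - z0)) = k"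
    unfolding eventually_at_right_field by (elim exE conjE)
  then have "F (z0 + 1 *\<^sub>R (z - z0)) - k = 0"
    using b by (intro real_polynomial_vanishing_interval[OF poly \<open>b > 0\<close>, of 1]) simp
  then show ?thesis by simp
qed

section \<open>Boundedness on a sector without Milnor arcs\<close>

text \<open>
  Arcs are given as functions of the distance to the origin, so \<open>g r\<close> and \<open>d r\<close> are points on the
  circle of radius \<open>r\<close>, and the sector consists of the circular arcs from \<open>g r\<close> counterclockwise
  to \<open>d r\<close>.
\<close>
definition sector :: "(real \<Rightarrow> complex) \<Rightarrow> (real \<Rightarrow> complex) \<Rightarrow> complex set" where
  "sector g d = {z. Arg2pi (z / g (norm z)) \<le> Arg2pi (d (norm z) / g (norm z))}"

definition open_sector :: "(real \<Rightarrow> complex) \<Rightarrow> (real \<Rightarrow> complex) \<Rightarrow> complex set" where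
  "open_sector g d = {z. 0 < Arg2pi (z / g (norm z)) \<and>
     Arg2pi (z / g (norm z)) < Arg2pi (d (norm z) / g (norm z))}"

lemma Arg2pi_positive_imp_not_nonneg_Reals: "Arg2pi z > 0 \<Longrightarrow> z \<notin> \<real>\<^sub>\<ge>\<^sub>0"
  by (metis Arg2pi_eq_0 complex_nonneg_Reals_iff complex_is_Real_iff less_irrefl)

lemma Arg2pi_quotient_cis:
  assumes "norm z = norm w" and "z \<noteq> 0"
  shows "z = w * cis (Arg2pi (z / w))"
proof -
  have "w \<noteq> 0" using assms by auto
  then have "norm (z / w) = 1" using assms by (simp add: norm_divide)
  then have "z / w = cis (Arg2pi (z / w))"
    using complex_norm_eq_1_exp[of "z / w"] by (simp add: cis_conv_exp)
  then show ?thesis using \<open>w \<noteq> 0\<close> by (simp add: field_simps)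
qed

lemma Arg2pi_cis: "0 \<le> t \<Longrightarrow> t < 2 * pi \<Longrightarrow> Arg2pi (cis t) = t"
  by (rule Arg2pi_unique[of 1]) (auto simp: cis_conv_exp)

lemma sector_angle_positive:
  assumes "norm (g r) = r" "norm (d r) = r" "g r \<noteq> d r" "0 < r"
  shows "0 < Arg2pi (d r / g r)"
proof (rule ccontr)
  assume "\<not> ?thesis"
  then have "Arg2pi (d r / g r) = 0" using Arg2pi_ge_0[of "d r / g r"] by linarith
  then have "d r = g r" using Arg2pi_quotient_cis[of "d r" "g r"] assms by fastforce
  then show False using assms by simp
qed

lemma isCont_imp_tendsto_nhds: "isCont f x \<Longrightarrow> (f \<longlongrightarrow> f x) (nhds x)"
  using tendsto_at_iff_tendsto_nhds[of f x] by (simp add: isCont_def)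

text \<open>
  A maximum principle for functions whose critical points along circles are singular points.
  The penalty \<open>e * norm z\<close> makes it possible to exclude interior maxima: at a singular point
  the radial derivative of \<open>F z - e * norm z\<close> is \<open>- e\<close>.
\<close>
lemma bounded_above_on_sector:
  fixes F :: "complex \<Rightarrow> real"
  assumes "0 < a"
    and g: "continuous_on {a..} g" "\<And>r. a \<le> r \<Longrightarrow> norm (g r) = r" "\<And>r. a \<le> r \<Longrightarrow> F (g r) \<le> B"
    and d: "continuous_on {a..} d" "\<And>r. a \<le> r \<Longrightarrow> norm (d r) = r" "\<And>r. a \<le> r \<Longrightarrow> F (d r) \<le> B"
    and neq: "\<And>r. a \<le> r \<Longrightarrow> g r \<noteq> d r"
    and F: "\<And>z. (F has_derivative F' z) (at z)"
    and crit: "\<And>z. z \<in> open_sector g d \<Longrightarrow> a \<le> norm z \<Longrightarrow> F' z (\<i> * z) = 0 \<Longrightarrow> F' z = (\<lambda>_. 0)"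
  shows "\<exists>K. \<forall>z\<in>sector g d. a \<le> norm z \<longrightarrow> F z \<le> K"
proof -
  define \<theta> where "\<theta> r = Arg2pi (d r / g r)" for r
  have g0: "g r \<noteq> 0" if "a \<le> r" for r using g(2)[OF that] that \<open>0 < a\<close> by auto
  have \<theta>pos: "0 < \<theta> r" if "a \<le> r" for r
    unfolding \<theta>_def using sector_angle_positive[of g r d] that g(2) d(2) neq \<open>0 < a\<close> by auto
  have \<theta>lt: "\<theta> r < 2 * pi" for r unfolding \<theta>_def by (rule Arg2pi_lt_2pi)
  have \<theta>cont: "continuous_on {a..} \<theta>"
    unfolding \<theta>_def continuous_on_eq_continuous_within
  proof
    fix r assume r: "r \<in> {a..}"
    have quot: "((\<lambda>r. d r / g r) \<longlongrightarrow> d r / g r) (at r within {a..})"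
      using g(1) d(1) r g0[of r] by (auto intro!: tendsto_divide simp: continuous_on_def)
    have arg: "isCont Arg2pi (d r / g r)"
      using \<theta>pos[of r] r by (intro continuous_at_Arg2pi Arg2pi_positive_imp_not_nonneg_Reals)
        (auto simp: \<theta>_def)
    show "continuous (at r within {a..}) (\<lambda>r. Arg2pi (d r / g r))"
      by (simp only: continuous_within) (rule isCont_tendsto_compose[OF arg quot])
  qed
  have Fcont: "continuous_on UNIV F"
    by (intro continuous_at_imp_continuous_on ballI has_derivative_continuous[OF F])
  obtain B0 where B0: "\<And>z. norm z \<le> a \<Longrightarrow> F z \<le> B0"
  proof -
    have "compact (F ` cball 0 a)"
      by (intro compact_continuous_image compact_cball) (rule continuous_on_subset[OF Fcont subset_UNIV])
    then have "bdd_above (F ` cball 0 a)"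
      by (intro bounded_imp_bdd_above compact_imp_bounded)
    then obtain M where "\<forall>z\<in>cball 0 a. F z \<le> M" by (auto simp: bdd_above_def)
    then show ?thesis by (intro that[of M]) simp
  qed
  define K where "K = max B B0"
  have "F z1 \<le> K" if z1: "z1 \<in> sector g d" "a \<le> norm z1" for z1
  proof (rule ccontr)
    assume "\<not> F z1 \<le> K"
    define b where "b = norm z1"
    have b: "a \<le> b" "0 < b" using z1 \<open>0 < a\<close> by (auto simp: b_def)
    \<comment> \<open>Small enough for the penalty not to hide the excess of \<open>F z1\<close> over \<open>K\<close>.\<close>
    define e where "e = (F z1 - K) / (2 * b)"
    have e: "0 < e" "F z1 - e * b > K"
      using b \<open>\<not> F z1 \<le> K\<close> by (auto simp: e_def field_simps)
    \<comment> \<open>The truncated sector is the continuous image of a rectangle, hence compact.\<close>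
    define \<Phi> where "\<Phi> = (\<lambda>(r, s). F (g r * cis (s * \<theta> r)) - e * r)"
    have in_image: "\<exists>p\<in>{a..b} \<times> {0..1}. \<Phi> p = F z - e * norm z"
      if z: "z \<in> sector g d" "a \<le> norm z" "norm z \<le> b" for z
    proof -
      let ?r = "norm z" let ?s = "Arg2pi (z / g ?r) / \<theta> ?r"
      have "z = g ?r * cis (Arg2pi (z / g ?r))"
        using z g(2) \<open>0 < a\<close> by (intro Arg2pi_quotient_cis) auto
      moreover have "?s * \<theta> ?r = Arg2pi (z / g ?r)" using \<theta>pos[of ?r] z by simp
      ultimately have "\<Phi> (?r, ?s) = F z - e * norm z" by (simp add: \<Phi>_def)
      moreover have "?s \<in> {0..1}"
        using z \<theta>pos[of ?r] Arg2pi_ge_0 by (auto simp: sector_def \<theta>_def)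
      ultimately show ?thesis using z by (intro bexI[of _ "(?r, ?s)"]) auto
    qed
    have "continuous_on ({a..b} \<times> {0..1}) \<Phi>"
    proof -
      have "continuous_on {a..b} g" "continuous_on {a..b} \<theta>"
        using g(1) \<theta>cont by (auto intro: continuous_on_subset)
      then have gc: "continuous_on ({a..b} \<times> {0..1::real}) (\<lambda>x. g (fst x))"
        and tc: "continuous_on ({a..b} \<times> {0..1::real}) (\<lambda>x. \<theta> (fst x))"
        by (auto elim!: continuous_on_compose2 intro!: continuous_on_fst continuous_on_id)
      have "continuous_on ({a..b} \<times> {0..1}) (\<lambda>x. g (fst x) * cis (snd x * \<theta> (fst x)))"
        by (intro continuous_intros gc tc)
      then have "continuous_on ({a..b} \<times> {0..1}) (\<lambda>x. F (g (fst x) * cis (snd x * \<theta> (fst x))))"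
        by (rule continuous_on_compose2[OF Fcont]) auto
      then show ?thesis
        unfolding \<Phi>_def case_prod_unfold by (intro continuous_intros)
    qed
    moreover have "compact ({a..b} \<times> {0..1::real})" "{a..b} \<times> {0..1::real} \<noteq> {}"
      using b by (auto intro: compact_Times)
    ultimately obtain r s where rs: "r \<in> {a..b}" "s \<in> {0..1}"
      and max: "\<And>p. p \<in> {a..b} \<times> {0..1} \<Longrightarrow> \<Phi> p \<le> \<Phi> (r, s)"
      using continuous_attains_sup[of "{a..b} \<times> {0..1}" \<Phi>] by auto
    define z where "z = g r * cis (s * \<theta> r)"
    have nz: "norm z = r" using g(2)[of r] rs by (simp add: z_def norm_mult)
    have maxz: "F w - e * norm w \<le> F z - e * norm z"
      if "w \<in> sector g d" "a \<le> norm w" "norm w \<le> b" for w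
    proof -
      have "\<Phi> (r, s) = F z - e * norm z" using nz by (simp add: \<Phi>_def z_def)
      then show ?thesis using in_image[OF that] max by metis
    qed
    have Fz: "F z > K"
    proof -
      have "F z - e * r > K" using maxz[OF z1] e nz by (simp add: b_def)
      moreover have "e * r \<ge> 0" using e rs \<open>0 < a\<close> by auto
      ultimately show ?thesis by linarith
    qed
    have "r \<noteq> a" using B0[of z] Fz nz by (auto simp: K_def)
    then have r: "a < r" "r \<le> b" using rs by auto
    have "s \<noteq> 0" using Fz g(3)[of r] rs by (auto simp: z_def K_def)
    moreover have "s \<noteq> 1"
    proof
      assume "s = 1"
      have "d r = g r * cis (\<theta> r)"
        unfolding \<theta>_def using r g(2)[of r] d(2)[of r] \<open>0 < a\<close> by (intro Arg2pi_quotient_cis) auto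
      then have "z = d r" using \<open>s = 1\<close> by (simp add: z_def)
      then show False using Fz d(3)[of r] rs by (auto simp: K_def)
    qed
    ultimately have s: "0 < s" "s < 1" using rs by auto
    have "s * \<theta> r < \<theta> r" using s \<theta>pos[of r] r by simp
    then have Argz: "Arg2pi (z / g r) = s * \<theta> r"
      using s \<theta>pos[of r] r less_trans[OF \<open>s * \<theta> r < \<theta> r\<close> \<theta>lt] g0[of r] by (auto simp: z_def intro!: Arg2pi_cis)
    then have zopen: "z \<in> open_sector g d"
      using \<open>s * \<theta> r < \<theta> r\<close> s \<theta>pos[of r] r nz by (simp add: open_sector_def \<theta>_def[symmetric])
    \<comment> \<open>The outer radius \<open>b\<close> is absent here: the maximum may lie on the outer circle, but the
      perturbations below stay on the circle through \<open>z\<close> or move inwards.\<close>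
    have near: "\<forall>\<^sub>F w in nhds z. w \<in> sector g d \<and> a \<le> norm w"
    proof -
      have "r \<in> interior {a..}" using r by simp
      then have gi: "isCont g r" and ti: "isCont \<theta> r"
        using continuous_on_interior[OF g(1)] continuous_on_interior[OF \<theta>cont] by simp_all
      have n: "isCont norm z" by (intro continuous_intros)
      have gn: "isCont (\<lambda>w. g (norm w)) z" and tn: "isCont (\<lambda>w. \<theta> (norm w)) z"
        using isCont_o2[OF n] gi ti nz by auto
      have "isCont (\<lambda>w. w / g (norm w)) z"
        using gn g0[of r] r nz by (intro continuous_intros) auto
      moreover have "isCont Arg2pi (z / g (norm z))"
        using Argz s \<theta>pos[of r] r nz
        by (intro continuous_at_Arg2pi Arg2pi_positive_imp_not_nonneg_Reals) auto
      ultimately have "isCont (\<lambda>w. Arg2pi (w / g (norm w))) z"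
        by (rule isCont_o2)
      with tn have "isCont (\<lambda>w. \<theta> (norm w) - Arg2pi (w / g (norm w))) z"
        by (intro continuous_intros)
      from order_tendstoD(1)[OF isCont_imp_tendsto_nhds[OF this], of 0]
      have "\<forall>\<^sub>F w in nhds z. 0 < \<theta> (norm w) - Arg2pi (w / g (norm w))"
        using Argz \<open>s * \<theta> r < \<theta> r\<close> nz by simp
      moreover have "\<forall>\<^sub>F w in nhds z. a < norm w"
        using order_tendstoD(1)[OF isCont_imp_tendsto_nhds[OF n], of a] r nz by simp
      ultimately show ?thesis
        by eventually_elim (auto simp: sector_def \<theta>_def)
    qed
    have tangential: "F' z (\<i> * z) = 0"
    proof -
      have c: "((\<lambda>t. z * cis t) has_derivative (\<lambda>t. t *\<^sub>R (\<i> * z))) (at 0)"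
        by (auto intro!: derivative_eq_intros simp: fun_eq_iff scaleR_conv_of_real)
      have "((\<lambda>t. F (z * cis t)) has_derivative (\<lambda>t. F' z (t *\<^sub>R (\<i> * z)))) (at 0)"
        using has_derivative_compose[OF c, of F "F' z"] F[of z] by simp
      moreover have "F' z (t *\<^sub>R (\<i> * z)) = t * F' z (\<i> * z)" for t
        using linear_cmul[OF has_derivative_linear[OF F[of z]]] by simp
      ultimately have der: "((\<lambda>t. F (z * cis t)) has_real_derivative F' z (\<i> * z)) (at 0)"
        by (simp add: has_field_derivative_def mult.commute[of _ "F' z (\<i> * z)"])
      have "((\<lambda>t. z * cis t) \<longlongrightarrow> z) (nhds (0::real))"
        using isCont_imp_tendsto_nhds[OF has_derivative_continuous[OF c]] by simp
      from eventually_compose_filterlim[OF near this]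
      have "\<forall>\<^sub>F t in nhds (0::real). z * cis t \<in> sector g d \<and> a \<le> norm (z * cis t)" .
      then obtain \<delta> where \<delta>: "\<delta> > 0" "\<And>t. dist t 0 < \<delta> \<Longrightarrow> z * cis t \<in> sector g d"
        by (auto simp: eventually_nhds_metric)
      have "\<forall>t. \<bar>0 - t\<bar> < \<delta> \<longrightarrow> F (z * cis t) \<le> F (z * cis 0)"
        using maxz[of "z * cis _"] \<delta>(2) r nz by (auto simp: norm_mult)
      with DERIV_local_max[OF der \<delta>(1)] show ?thesis by blast
    qed
    have "F' z = (\<lambda>_. 0)" using crit[OF zopen _ tangential] r nz by simp
    have c: "((\<lambda>t::real. z - t *\<^sub>R z) has_derivative (\<lambda>t. - (t *\<^sub>R z))) (at 0)"
      by (auto intro!: derivative_eq_intros)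
    have "((\<lambda>t. F (z - t *\<^sub>R z)) has_derivative (\<lambda>t. F' z (- (t *\<^sub>R z)))) (at 0)"
      using has_derivative_compose[OF c, of F "F' z"] F[of z] by simp
    then have "((\<lambda>t. F (z - t *\<^sub>R z)) has_real_derivative 0) (at 0)"
      unfolding \<open>F' z = (\<lambda>_. 0)\<close> has_field_derivative_def by (simp add: lambda_zero)
    then have "((\<lambda>t. F (z - t *\<^sub>R z) - e * (r * (1 - t))) has_real_derivative e * r) (at 0)"
      by (auto intro!: derivative_eq_intros)
    moreover have "e * r > 0" using e r \<open>0 < a\<close> by simp
    ultimately obtain h where h: "h > 0" "\<And>t. 0 < t \<Longrightarrow> t < h \<Longrightarrow>
        F (z - 0 *\<^sub>R z) - e * (r * (1 - 0)) < F (z - t *\<^sub>R z) - e * (r * (1 - t))"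
      using DERIV_pos_inc_right[of _ "e * r" 0] by fastforce
    have "((\<lambda>t::real. z - t *\<^sub>R z) \<longlongrightarrow> z) (at_right 0)"
      by (auto intro!: tendsto_eq_intros)
    from eventually_compose_filterlim[OF near this]
    have "\<forall>\<^sub>F t in at_right 0. z - t *\<^sub>R z \<in> sector g d \<and> a \<le> norm (z - t *\<^sub>R z)" .
    moreover have "\<forall>\<^sub>F t in at_right 0. t \<in> {0<..<min h 1}"
      using h(1) by (intro eventually_at_right_real) simp
    ultimately have "\<forall>\<^sub>F t::real in at_right 0. False"
    proof eventually_elim
      case (elim t)
      have "z - t *\<^sub>R z = (1 - t) *\<^sub>R z" by (simp add: algebra_simps)
      then have nt: "norm (z - t *\<^sub>R z) = r * (1 - t)" using elim nz by simp
      also have "\<dots> \<le> r" using r elim \<open>0 < a\<close> by (intro mult_left_le) auto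
      also have "\<dots> \<le> b" by fact
      finally have "F (z - t *\<^sub>R z) - e * (r * (1 - t)) \<le> F z - e * r"
        using maxz[of "z - t *\<^sub>R z"] elim nt nz by auto
      then show False using h(2)[of t] elim by simp
    qed
    then show False by simp
  qed
  then show ?thesis by blast
qed

section \<open>Half-lines inside a sector\<close>

text \<open>A polynomial in one variable that is bounded near infinity is constant.\<close>
lemma half_line_in_sector_imp_constant:
  fixes F :: "complex \<Rightarrow> real"
  assumes "real_polynomial_function F"
    and bound: "\<And>z. z \<in> sector g d \<Longrightarrow> a \<le> norm z \<Longrightarrow> \<bar>F z\<bar> \<le> K"
    and "u \<noteq> 0" and ev: "\<forall>\<^sub>F s in at_top. p + s *\<^sub>R u \<in> sector g d"
  shows "F (p + s *\<^sub>R u) = F (p + t *\<^sub>R u)"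
proof -
  have poly: "real_polynomial_function (\<lambda>s. F (p + s *\<^sub>R u))"
    using assms(1) by (rule real_polynomial_function_line)
  have "\<forall>\<^sub>F s::real in at_top. s * norm u - norm p \<ge> a"
    using \<open>u \<noteq> 0\<close> by real_asymp
  then have "\<forall>\<^sub>F s in at_top. \<bar>F (p + s *\<^sub>R u)\<bar> \<le> K"
    using ev eventually_ge_at_top[of 0]
  proof eventually_elim
    case (elim s)
    have "norm (s *\<^sub>R u) \<le> norm (p + s *\<^sub>R u) + norm p"
      using norm_triangle_ineq4[of "p + s *\<^sub>R u" p] by simp
    then show ?case using elim bound by simp
  qed
  from bounded_real_polynomial_half_line[OF poly this] show ?thesis .
qed

text \<open>
  The sector eventually contains every ray whose angle to the limit direction \<open>v\<close> of its first
  arc is positive and below \<open>e\<close>.  All these rays lie on lines through \<open>0\<close>, so \<open>F\<close>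
  takes the value \<open>F 0\<close> on an open cone.
\<close>
lemma wide_sector_imp_constant:
  fixes F :: "complex \<Rightarrow> real"
  assumes poly: "real_polynomial_function F"
    and bound: "\<And>z. z \<in> sector g d \<Longrightarrow> a \<le> norm z \<Longrightarrow> \<bar>F z\<bar> \<le> K"
    and "norm v = 1" and lim: "((\<lambda>r. g r / of_real r) \<longlongrightarrow> v) at_top"
    and "0 < e" and wide: "\<forall>\<^sub>F r in at_top. e \<le> Arg2pi (d r / g r)"
  shows "F z = F 0"
proof -
  \<comment> \<open>Angles below \<open>e'\<close> stay in the range where \<open>Arg2pi\<close> inverts \<open>cis\<close>.\<close>
  define e' where "e' = min e pi"
  have e': "0 < e'" "e' < 2 * pi" "e' \<le> e" using \<open>0 < e\<close> pi_gt_zero by (auto simp: e'_def min_def)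
  have v: "v \<noteq> 0" using \<open>norm v = 1\<close> by auto
  have ray: "F (s *\<^sub>R (v * cis \<psi>)) = F 0" if \<psi>: "0 < \<psi>" "\<psi> < e'" for s \<psi>
  proof -
    have arg: "Arg2pi (cis \<psi>) = \<psi>" using \<psi> e' by (intro Arg2pi_cis) auto
    have "((\<lambda>r. v * cis \<psi> / (g r / of_real r)) \<longlongrightarrow> v * cis \<psi> / v) at_top"
      by (intro tendsto_intros lim v)
    then have "((\<lambda>r. v * cis \<psi> / (g r / of_real r)) \<longlongrightarrow> cis \<psi>) at_top"
      using v by simp
    moreover have "isCont Arg2pi (cis \<psi>)"
      using \<psi> arg by (intro continuous_at_Arg2pi Arg2pi_positive_imp_not_nonneg_Reals) auto
    ultimately have "((\<lambda>r. Arg2pi (v * cis \<psi> / (g r / of_real r))) \<longlongrightarrow> \<psi>) at_top"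
      using isCont_tendsto_compose arg by fastforce
    then have "\<forall>\<^sub>F r in at_top. Arg2pi (v * cis \<psi> / (g r / of_real r)) < e'"
      using \<psi> by (auto intro: order_tendstoD)
    then have "\<forall>\<^sub>F r in at_top. 0 + r *\<^sub>R (v * cis \<psi>) \<in> sector g d"
      using wide eventually_gt_at_top[of 0]
    proof eventually_elim
      case (elim r)
      have "norm (r *\<^sub>R (v * cis \<psi>)) = r" using elim \<open>norm v = 1\<close> by (simp add: norm_mult)
      moreover have "r *\<^sub>R (v * cis \<psi>) / g r = v * cis \<psi> / (g r / of_real r)"
        using elim by (simp add: scaleR_conv_of_real)
      then have "Arg2pi (r *\<^sub>R (v * cis \<psi>) / g r) < e'"
        using elim by (simp only:)
      then have "Arg2pi (r *\<^sub>R (v * cis \<psi>) / g r) \<le> Arg2pi (d r / g r)"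
        using elim e' by linarith
      ultimately show ?case by (simp only: sector_def mem_Collect_eq add_0)
    qed
    then have "F (0 + s *\<^sub>R (v * cis \<psi>)) = F (0 + 0 *\<^sub>R (v * cis \<psi>))"
      using v by (intro half_line_in_sector_imp_constant[OF poly bound]) auto
    then show ?thesis by simp
  qed
  define z0 where "z0 = v * cis (e' / 2)"
  have arg: "Arg2pi (z0 / v) = e' / 2"
    using e' v by (simp add: z0_def Arg2pi_cis)
  have "isCont Arg2pi (z0 / v)"
    using e' arg by (intro continuous_at_Arg2pi Arg2pi_positive_imp_not_nonneg_Reals) auto
  moreover have "((\<lambda>z. z / v) \<longlongrightarrow> z0 / v) (nhds z0)"
    using v by (intro tendsto_intros filterlim_ident)
  ultimately have lim0: "((\<lambda>z. Arg2pi (z / v)) \<longlongrightarrow> e' / 2) (nhds z0)"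
    using isCont_tendsto_compose arg by fastforce
  have "\<forall>\<^sub>F z in nhds z0. 0 < Arg2pi (z / v)" "\<forall>\<^sub>F z in nhds z0. Arg2pi (z / v) < e'"
    using order_tendstoD[OF lim0] e' by auto
  then have "\<forall>\<^sub>F z in nhds z0. F z = F 0"
  proof eventually_elim
    case (elim z)
    have "z = norm z *\<^sub>R (v * cis (Arg2pi (z / v)))"
    proof (cases "z = 0")
      case False
      have "z = (norm z *\<^sub>R v) * cis (Arg2pi (z / (norm z *\<^sub>R v)))"
        using False \<open>norm v = 1\<close> by (intro Arg2pi_quotient_cis) auto
      also have "Arg2pi (z / (norm z *\<^sub>R v)) = Arg2pi (z / v)"
        using False Arg2pi_divide_of_real[of "norm z" "z / v"]
        by (simp add: scaleR_conv_of_real mult.commute)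
      finally show ?thesis by simp
    qed simp
    then show ?case using ray elim by metis
  qed
  from real_polynomial_vanishing_open_set[OF poly this] show ?thesis .
qed

lemma Complex_times_eq: "Complex x y * v = x *\<^sub>R v + y *\<^sub>R (\<i> * v)"
  by (simp add: complex_eq_iff algebra_simps)

text \<open>
  \<open>F\<close> is constant on each line of the strip; for a fixed translation, the difference of the
  translated and the original values is a polynomial in the height that vanishes on an interval.
\<close>
lemma strip_in_sector_imp_translation_invariant:
  fixes F :: "complex \<Rightarrow> real"
  assumes poly: "real_polynomial_function F"
    and bound: "\<And>z. z \<in> sector g d \<Longrightarrow> a \<le> norm z \<Longrightarrow> \<bar>F z\<bar> \<le> K"
    and v: "v \<noteq> 0" and "c1 < c2"
    and strip: "\<And>c. c1 < c \<Longrightarrow> c < c2 \<Longrightarrow> \<forall>\<^sub>F s in at_top. Complex s c * v \<in> sector g d"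
  shows "F (z + t *\<^sub>R v) = F z"
proof -
  have split: "Complex s c * v = c *\<^sub>R (\<i> * v) + s *\<^sub>R v" for s c
    by (simp only: Complex_times_eq add.commute)
  define X Y where "X = Re (z / v)" and "Y = Im (z / v)"
  define q where "q c = F ((X + t) *\<^sub>R v + c *\<^sub>R (\<i> * v)) - F (X *\<^sub>R v + c *\<^sub>R (\<i> * v))" for c
  have "real_polynomial_function q"
    unfolding q_def by (intro real_polynomial_function_diff real_polynomial_function_line poly)
  then have "q Y = 0"
  proof (rule real_polynomial_vanishing_interval[OF _ \<open>c1 < c2\<close>])
    fix c assume "c1 < c" "c < c2"
    have "F (c *\<^sub>R (\<i> * v) + (X + t) *\<^sub>R v) = F (c *\<^sub>R (\<i> * v) + X *\<^sub>R v)"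
      using strip[OF \<open>c1 < c\<close> \<open>c < c2\<close>, unfolded split]
      by (intro half_line_in_sector_imp_constant[OF poly bound v]) auto
    then show "q c = 0" by (simp add: q_def add.commute)
  qed
  moreover have "z = X *\<^sub>R v + Y *\<^sub>R (\<i> * v)"
  proof -
    have "z = Complex X Y * v" using v by (simp add: X_def Y_def)
    then show ?thesis by (simp add: split add.commute)
  qed
  ultimately show ?thesis
    by (simp add: q_def algebra_simps)
qed

section \<open>Arcs asymptotic to the same direction\<close>

text \<open>
  On a half-circle in the right half-plane the angle is an increasing function of the height,
  which turns comparisons of angles into comparisons of heights.
\<close>
lemma right_half_plane_polar:
  assumes "0 < X"
  shows "Complex X Y = norm (Complex X Y) *\<^sub>R cis (arcsin (Y / norm (Complex X Y)))"
proof -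
  define r where "r = norm (Complex X Y)"
  have "Complex X Y \<noteq> 0" using assms by (simp add: complex_eq_iff)
  then have r: "r > 0" "r\<^sup>2 = X\<^sup>2 + Y\<^sup>2" by (simp_all add: r_def cmod_power2)
  have Y: "\<bar>Y\<bar> \<le> r" using abs_Im_le_cmod[of "Complex X Y"] by (simp add: r_def)
  then have Yr: "-1 \<le> Y / r" "Y / r \<le> 1" using r by (auto simp: field_simps)
  have "(X / r)\<^sup>2 + (Y / r)\<^sup>2 = 1"
    using r by (simp add: power_divide flip: add_divide_distrib r(2))
  then have "1 - (Y / r)\<^sup>2 = (X / r)\<^sup>2" by linarith
  then have "cos (arcsin (Y / r)) = sqrt ((X / r)\<^sup>2)" using cos_arcsin[OF Yr] by simp
  also have "\<dots> = X / r" using r(1) assms by simp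
  finally show ?thesis
    using r Yr by (simp add: complex_eq_iff r_def[symmetric])
qed

lemma heights_imp_mem_sector:
  assumes "0 < X" "0 < X'" "0 < x" "v \<noteq> 0"
    and norms: "norm (Complex X Y) = r" "norm (Complex X' Y') = r" "norm (Complex x c) = r"
    and gd: "g (r * norm v) = Complex X Y * v" "d (r * norm v) = Complex X' Y' * v"
    and "Y < c" "c < Y'"
  shows "Complex x c * v \<in> sector g d"
proof -
  have r: "0 < r" using norms \<open>0 < X\<close> by (auto simp: complex_eq_iff)
  have le: "\<bar>Y\<bar> \<le> r" "\<bar>Y'\<bar> \<le> r" "\<bar>c\<bar> \<le> r"
    using norms abs_Im_le_cmod complex.sel by metis+
  define A where "A y = arcsin (y / r)" for y
  have A: "A Y < A c" "A c < A Y'"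
    unfolding A_def using le r assms(10,11) by (auto intro!: arcsin_less_mono[THEN iffD2] simp: field_simps abs_le_iff)
  have bounds: "- (pi / 2) \<le> A y \<and> A y \<le> pi / 2" if "\<bar>y\<bar> \<le> r" for y
    unfolding A_def by (rule arcsin_bounded) (use that r in \<open>auto simp: field_simps abs_le_iff\<close>)
  have A': "A Y' - A Y < 2 * pi"
    using bounds[OF le(1)] bounds[OF le(2)] pi_gt_zero by linarith
  have polar: "Complex X Y = r *\<^sub>R cis (A Y)" "Complex X' Y' = r *\<^sub>R cis (A Y')"
    "Complex x c = r *\<^sub>R cis (A c)"
    using right_half_plane_polar[of X Y] right_half_plane_polar[of X' Y']
      right_half_plane_polar[of x c] assms(1-3) norms by (simp_all add: A_def)
  have "norm (Complex x c * v) = r * norm v" using norms by (simp add: norm_mult)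
  moreover have "Complex x c * v / (Complex X Y * v) = cis (A c - A Y)"
    "Complex X' Y' * v / (Complex X Y * v) = cis (A Y' - A Y)"
    unfolding polar using r \<open>v \<noteq> 0\<close> by (simp_all add: scaleR_conv_of_real cis_divide)
  ultimately show ?thesis
    using A A' by (simp add: sector_def gd Arg2pi_cis)
qed

text \<open>
  The second arc lies below the first one in the right half-plane, so the counterclockwise way
  to it passes through the whole left half-plane.
\<close>
lemma heights_imp_wide_angle:
  assumes "0 < X" "0 < X'" "v \<noteq> 0" "norm (Complex X Y) = norm (Complex X' Y')" "Y' < Y"
  shows "pi \<le> Arg2pi ((Complex X' Y' * v) / (Complex X Y * v))"
proof -
  define r where "r = norm (Complex X Y)"
  have r: "0 < r" using assms(1) by (auto simp: r_def complex_eq_iff)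
  have le: "\<bar>Y\<bar> \<le> r" "\<bar>Y'\<bar> \<le> r"
    using abs_Im_le_cmod[of "Complex X Y"] abs_Im_le_cmod[of "Complex X' Y'"] assms(4)
    by (auto simp: r_def)
  define A where "A y = arcsin (y / r)" for y
  have "A Y' < A Y"
    unfolding A_def using le r assms(5)
    by (auto intro!: arcsin_less_mono[THEN iffD2] simp: field_simps abs_le_iff)
  moreover have bounds: "- (pi / 2) \<le> A y \<and> A y \<le> pi / 2" if "\<bar>y\<bar> \<le> r" for y
    unfolding A_def by (rule arcsin_bounded) (use that r in \<open>auto simp: field_simps abs_le_iff\<close>)
  then have "- (pi / 2) \<le> A Y'" "A Y \<le> pi / 2" using le by blast+
  moreover have "(Complex X' Y' * v) / (Complex X Y * v) = cis (2 * pi + (A Y' - A Y))"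
  proof -
    have "Complex X Y = r *\<^sub>R cis (A Y)" "Complex X' Y' = r *\<^sub>R cis (A Y')"
      using right_half_plane_polar[of X Y] right_half_plane_polar[of X' Y'] assms
      by (simp_all add: A_def r_def)
    moreover have "cis (2 * pi + (A Y' - A Y)) = cis (A Y' - A Y)"
      by (simp add: cis_mult[symmetric, of "2 * pi"])
    ultimately show ?thesis
      using r assms(3) by (simp add: scaleR_conv_of_real cis_divide)
  qed
  ultimately show ?thesis by (simp add: Arg2pi_cis)
qed

section \<open>Radial sections of Milnor arcs\<close>

text \<open>
  The identification of the complex numbers with the plane, which makes rotations
  multiplications by \<open>cis\<close>.
\<close>
definition plane :: "complex \<Rightarrow> real^2" where
  "plane z = vector [Re z, Im z]"

lemma plane_component [simp]: "plane z $ 1 = Re z" "plane z $ 2 = Im z"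
  by (simp_all add: plane_def)

lemma plane_Complex [simp]: "plane (Complex (x $ 1) (x $ 2)) = x"
  by (simp add: vec_eq_iff forall_2)

lemma plane_eq_iff: "plane z = plane w \<longleftrightarrow> z = w"
  by (auto simp: vec_eq_iff forall_2 complex_eq_iff)

lemma norm_plane [simp]: "norm (plane z) = norm z"
  by (simp add: norm_vec_def L2_set_def sum_2 cmod_def)

lemma bounded_linear_plane: "bounded_linear plane"
  by (rule linear_conv_bounded_linear[THEN iffD1], rule linearI) (auto simp: vec_eq_iff forall_2)

lemma rotate_ccw_plane: "rotate_ccw \<theta> (plane z) = plane (cis \<theta> * z)"
  by (simp add: rotate_ccw_def vec_eq_iff forall_2)

text \<open>Outside a disk an arc meets each circle in exactly one point; \<open>g r\<close> is the point at distance \<open>r\<close>.\<close>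
definition radial_section :: "real \<Rightarrow> (real^2) set \<Rightarrow> (real \<Rightarrow> complex) \<Rightarrow> bool" where
  "radial_section a G g \<longleftrightarrow> 0 < a \<and> continuous_on {a..} g \<and>
     (\<forall>r\<ge>a. norm (g r) = r \<and> plane (g r) \<in> G) \<and>
     (\<forall>z. a \<le> norm z \<longrightarrow> plane z \<in> G \<longrightarrow> g (norm z) = z)"

lemma radial_section_mono: "radial_section a G g \<Longrightarrow> a \<le> b \<Longrightarrow> radial_section b G g"
  unfolding radial_section_def by (auto elim: continuous_on_subset)

text \<open>
  The norm is a continuous injective map of the arc onto an unbounded interval, hence a
  homeomorphism; its inverse is the section.
\<close>
lemma parametrised_arc_radial_section:
  assumes param: "parametrises 0 R G c" and lim: "((\<lambda>s. ereal (f (c s))) \<longlongrightarrow> ereal l) at_top"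
  obtains a g B where "radial_section a G g" "\<And>r. a \<le> r \<Longrightarrow> \<bar>f (plane (g r))\<bar> \<le> B"
proof -
  obtain d where hom: "homeomorphism {R<..} G c d"
    and mono: "strict_mono_on {R<..} (\<lambda>s. norm (c s))"
    and top: "filterlim (\<lambda>s. norm (c s)) at_top at_top"
    using param by (auto simp: parametrises_def)
  have G: "G = c ` {R<..}" and cont: "continuous_on {R<..} c"
    using hom by (auto simp: homeomorphism_def)
  have less_iff: "norm (c s) < norm (c t) \<longleftrightarrow> s < t" if "s > R" "t > R" for s t
    using strict_mono_on_less[OF mono] that by simp
  have inj: "inj_on norm G"
  proof (rule inj_onI)
    fix x y assume "x \<in> G" "y \<in> G" "norm x = norm y"
    then obtain s t where "s > R" "t > R" "x = c s" "y = c t" by (auto simp: G)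
    then show "x = y"
      using less_iff[of s t] less_iff[of t s] \<open>norm x = norm y\<close> by (cases s t rule: linorder_cases) auto
  qed
  have pc: "path_connected G"
    unfolding G by (intro path_connected_continuous_image cont convex_imp_path_connected) simp
  have "continuous_on G (norm :: real^2 \<Rightarrow> real)" by (intro continuous_intros)
  from homeomorphism_into_1d[OF pc this refl inj]
  obtain \<gamma> where \<gamma>: "homeomorphism G (norm ` G) norm \<gamma>" by blast
  have "((\<lambda>s. f (c s)) \<longlongrightarrow> l) at_top" using lim by simp
  then have "\<forall>\<^sub>F s in at_top. \<bar>f (c s)\<bar> < \<bar>l\<bar> + 1"
    by (intro order_tendstoD(2)[OF tendsto_rabs]) auto
  then obtain s1 where s1: "\<And>s. s1 \<le> s \<Longrightarrow> \<bar>f (c s)\<bar> < \<bar>l\<bar> + 1"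
    by (auto simp: eventually_at_top_linorder)
  define s0 where "s0 = max s1 (R + 1)"
  define a where "a = norm (c s0) + 1"
  have img: "r \<in> norm ` G" if "a \<le> r" for r
  proof -
    have "\<forall>\<^sub>F s in at_top. r \<le> norm (c s) \<and> s > R"
      using top by (auto simp: filterlim_at_top eventually_gt_at_top intro: eventually_conj)
    then obtain s where s: "r \<le> norm (c s)" "s > R"
      using eventually_happens'[of "at_top :: real filter"] by auto
    have "connected (norm ` G)"
      by (intro connected_continuous_image path_connected_imp_connected pc continuous_intros)
    then have "{norm (c s0)..norm (c s)} \<subseteq> norm ` G"
      by (rule connected_contains_Icc) (use s in \<open>auto simp: G s0_def\<close>)
    then show ?thesis using s that by (auto simp: a_def)
  qed
  define g where "g r = Complex (\<gamma> r $ 1) (\<gamma> r $ 2)" for r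
  have g: "plane (g r) = \<gamma> r" for r by (simp add: g_def)
  have "continuous_on (norm ` G) \<gamma>" using \<gamma> by (simp add: homeomorphism_def)
  then have "continuous_on {a..} \<gamma>" using img by (auto elim!: continuous_on_subset)
  then have gc: "continuous_on {a..} g"
    unfolding g_def Complex_eq by (intro continuous_intros)
  have in_G: "\<gamma> r \<in> G" "norm (\<gamma> r) = r" if "a \<le> r" for r
    using img[OF that] \<gamma> by (auto simp: homeomorphism_def)
  have unique: "g (norm z) = z" if "plane z \<in> G" for z
  proof -
    have "\<gamma> (norm (plane z)) = plane z" using homeomorphism_apply1[OF \<gamma> that] .
    then show ?thesis using g[of "norm z"] plane_eq_iff by simp
  qed
  have "radial_section a G g"
    unfolding radial_section_def using gc unique in_G g norm_plane[of "g _"]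
    by (auto simp: a_def add_nonneg_pos)
  moreover have "\<bar>f (plane (g r))\<bar> \<le> \<bar>l\<bar> + 1" if "a \<le> r" for r
  proof -
    have "\<gamma> r \<in> c ` {R<..}" using in_G(1)[OF that] by (simp only: G)
    then obtain s where s: "s > R" "\<gamma> r = c s" by blast
    have "norm (c s0) < norm (c s)" using in_G(2)[OF that] s that by (simp add: a_def)
    then have "s0 < s" using less_iff[of s0 s] s by (simp add: s0_def)
    then show ?thesis using s1[of s] s g by (simp add: s0_def)
  qed
  ultimately show ?thesis by (rule that)
qed

section \<open>Points and directions at infinity\<close>

lemma homogeneous_eq_iff:
  assumes "u \<noteq> 0" "v \<noteq> 0"
  shows "homogeneous u = homogeneous v \<longleftrightarrow> proportional u v"
proof -
  have "proportional u u" "proportional v v"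
    using assms by (auto simp: proportional_def intro: exI[of _ 1])
  then show ?thesis
    using Quotient3_rel[OF Quotient3_proj_plane, of u v] by simp
qed

text \<open>
  Immediate from the quotient topology: the preimage of an open set is open in
  \<open>\<real>\<^sup>3 - {0}\<close>.
\<close>
lemma tendsto_homogeneous:
  assumes "(h \<longlongrightarrow> v) F" "v \<noteq> 0"
  shows "((\<lambda>x. homogeneous (h x)) \<longlongrightarrow> homogeneous v) F"
proof (rule topological_tendstoI)
  fix S assume "open S" "homogeneous v \<in> S"
  then have "open {v. v \<noteq> 0 \<and> homogeneous v \<in> S}" "v \<in> {v. v \<noteq> 0 \<and> homogeneous v \<in> S}"
    using \<open>v \<noteq> 0\<close> by (auto simp: open_proj_plane_def)
  from topological_tendstoD[OF assms(1) this]
  show "\<forall>\<^sub>F x in F. homogeneous (h x) \<in> S" by eventually_elim auto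
qed

definition ideal_point :: "complex \<Rightarrow> proj_plane" where
  "ideal_point v = homogeneous (vector [Re v, Im v, 0])"

lemma proj_embed_plane:
  assumes "r \<noteq> 0"
  shows "proj_embed (plane z) = homogeneous (vector [Re (z / of_real r), Im (z / of_real r), 1 / r])"
proof -
  have "vector [Re z, Im z, 1] = r *\<^sub>R (vector [Re (z / of_real r), Im (z / of_real r), 1 / r] :: real^3)"
    using assms by (simp add: vec_eq_iff forall_3)
  moreover have "vector [Re z, Im z, 1] \<noteq> (0 :: real^3)"
    "vector [Re (z / of_real r), Im (z / of_real r), 1 / r] \<noteq> (0 :: real^3)"
    using assms by (simp_all add: vec_eq_iff forall_3)
  ultimately show ?thesis
    unfolding proj_embed_def using assms
    by (simp add: homogeneous_eq_iff) (auto simp: proportional_def)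
qed

lemma ideal_vector_nonzero: "v \<noteq> 0 \<Longrightarrow> vector [Re v, Im v, 0] \<noteq> (0 :: real^3)"
  by (auto simp: vec_eq_iff forall_3 complex_eq_iff)

lemma ideal_point_eq_imp:
  assumes "norm v = 1" "norm w = 1" "ideal_point v = ideal_point w"
  shows "v = w \<or> v = - w"
proof -
  have "v \<noteq> 0" "w \<noteq> 0" using assms by auto
  then have "proportional (vector [Re v, Im v, 0]) (vector [Re w, Im w, 0])"
    using assms(3) homogeneous_eq_iff ideal_vector_nonzero unfolding ideal_point_def by blast
  then obtain k where "vector [Re v, Im v, 0] = k *\<^sub>R (vector [Re w, Im w, 0] :: real^3)"
    by (auto simp: proportional_def)
  then have v: "v = k *\<^sub>R w" by (simp add: vec_eq_iff forall_3 complex_eq_iff)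
  then have "\<bar>k\<bar> = 1" using assms by simp
  then have "k = 1 \<or> k = -1" by linarith
  then show ?thesis using v by auto
qed

lemma tendsto_proj_embed_ideal_point:
  assumes "filterlim \<rho> at_top F" "((\<lambda>x. h x / of_real (\<rho> x)) \<longlongrightarrow> v) F" "v \<noteq> 0"
  shows "((\<lambda>x. proj_embed (plane (h x))) \<longlongrightarrow> ideal_point v) F"
proof -
  have "((\<lambda>x. 1 / \<rho> x) \<longlongrightarrow> 0) F"
    using tendsto_inverse_0_at_top[OF assms(1)] by (simp add: inverse_eq_divide)
  moreover have "((\<lambda>x. Re (h x / of_real (\<rho> x))) \<longlongrightarrow> Re v) F" "((\<lambda>x. Im (h x / of_real (\<rho> x))) \<longlongrightarrow> Im v) F"
    using assms(2) by (intro tendsto_intros; assumption)+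
  ultimately have comp: "((\<lambda>x. Re (h x / of_real (\<rho> x))) \<longlongrightarrow> Re v) F"
      "((\<lambda>x. Im (h x / of_real (\<rho> x))) \<longlongrightarrow> Im v) F" "((\<lambda>x. 1 / \<rho> x) \<longlongrightarrow> 0) F"
    by blast+
  have "((\<lambda>x. vector [Re (h x / of_real (\<rho> x)), Im (h x / of_real (\<rho> x)), 1 / \<rho> x] :: real^3)
      \<longlongrightarrow> vector [Re v, Im v, 0]) F"
  proof (rule vec_tendstoI)
    fix i :: 3
    show "((\<lambda>x. (vector [Re (h x / of_real (\<rho> x)), Im (h x / of_real (\<rho> x)), 1 / \<rho> x] :: real^3) $ i)
      \<longlongrightarrow> (vector [Re v, Im v, 0] :: real^3) $ i) F"
      using exhaust_3[of i] comp by (elim disjE) (simp_all only: vector_3)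
  qed
  from tendsto_homogeneous[OF this ideal_vector_nonzero[OF assms(3)]]
  have "((\<lambda>x. homogeneous (vector [Re (h x / of_real (\<rho> x)), Im (h x / of_real (\<rho> x)), 1 / \<rho> x])) \<longlongrightarrow> ideal_point v) F"
    by (simp add: ideal_point_def)
  moreover have "\<forall>\<^sub>F x in F. \<rho> x \<noteq> 0"
    using assms(1) by (metis (mono_tags, lifting) eventually_mono filterlim_at_top_dense less_irrefl)
  then have "\<forall>\<^sub>F x in F. homogeneous (vector [Re (h x / of_real (\<rho> x)), Im (h x / of_real (\<rho> x)), 1 / \<rho> x])
      = proj_embed (plane (h x))"
    by eventually_elim (rule proj_embed_plane[symmetric])
  ultimately show ?thesis by (rule Lim_transform_eventually)
qed

lemma limit_direction_at_infinity:
  assumes "filterlim \<rho> at_top F" "F \<noteq> bot" "((\<lambda>x. h x / of_real (\<rho> x)) \<longlongrightarrow> v) F" "v \<noteq> 0"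
    and "\<forall>\<^sub>F x in F. plane (h x) \<in> G"
  shows "ideal_point v \<in> points_at_infinity G"
proof -
  have "ideal_point v \<in> closure (proj_embed ` G)"
  proof (rule Lim_in_closed_set[OF closed_closure _ assms(2)])
    show "((\<lambda>x. proj_embed (plane (h x))) \<longlongrightarrow> ideal_point v) F"
      by (rule tendsto_proj_embed_ideal_point[OF assms(1,3,4)])
    show "\<forall>\<^sub>F x in F. proj_embed (plane (h x)) \<in> closure (proj_embed ` G)"
      using assms(5) by eventually_elim (rule subsetD[OF closure_subset], simp)
  qed
  moreover have "ideal_point v \<in> line_at_infinity"
    using \<open>v \<noteq> 0\<close> by (auto simp: ideal_point_def line_at_infinity_def complex_eq_iff)
  ultimately show ?thesis by (simp add: points_at_infinity_def)
qed

text \<open>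
  Each accumulation point of \<open>g r / r\<close> on the unit circle gives a point at infinity of the arc.
  As there is only one such point, the accumulation points are among two opposite vectors \<open>v0\<close>
  and \<open>- v0\<close>, and connectedness of the arc selects one of them.
\<close>
lemma radial_section_direction:
  assumes sec: "radial_section a G g" and unique: "\<exists>!p. p \<in> points_at_infinity G"
  obtains v where "norm v = 1" "((\<lambda>r. g r / of_real r) \<longlongrightarrow> v) at_top"
    "point_at_infinity G = ideal_point v"
proof -
  have a: "0 < a" and gc: "continuous_on {a..} g" and gr: "\<And>r. a \<le> r \<Longrightarrow> norm (g r) = r"
    and gG: "\<And>r. a \<le> r \<Longrightarrow> plane (g r) \<in> G"
    using sec by (auto simp: radial_section_def)
  define u where "u r = g r / of_real r" for r
  have nu: "norm (u r) = 1" if "a \<le> r" for r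
    using gr[OF that] that a by (simp add: u_def norm_divide)
  have subseq: "\<exists>v \<sigma>. norm v = 1 \<and> strict_mono \<sigma> \<and> (\<lambda>n. u (\<rho> (\<sigma> n))) \<longlonglongrightarrow> v \<and>
      ideal_point v = point_at_infinity G"
    if \<rho>: "\<And>n. a + real n \<le> \<rho> n" for \<rho> :: "nat \<Rightarrow> real"
  proof -
    have ge: "a \<le> \<rho> n" for n using \<rho>[of n] by linarith
    have "\<forall>n. (u \<circ> \<rho>) n \<in> sphere 0 1" using nu ge by simp
    then obtain v \<sigma> where v: "v \<in> sphere 0 1" "strict_mono \<sigma>" "((u \<circ> \<rho>) \<circ> \<sigma>) \<longlonglongrightarrow> v"
      using compact_sphere[of "0::complex" 1] unfolding compact_def by meson
    have "filterlim \<rho> at_top sequentially"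
    proof (rule filterlim_at_top_mono[OF filterlim_real_sequentially], rule always_eventually, rule allI)
      show "real n \<le> \<rho> n" for n using \<rho>[of n] a by linarith
    qed
    then have top: "filterlim (\<lambda>n. \<rho> (\<sigma> n)) at_top sequentially"
      using v(2) filterlim_compose filterlim_subseq by blast
    have "ideal_point v \<in> points_at_infinity G"
    proof (rule limit_direction_at_infinity[OF top trivial_limit_sequentially])
      show "(\<lambda>n. g (\<rho> (\<sigma> n)) / of_real (\<rho> (\<sigma> n))) \<longlonglongrightarrow> v" using v(3) by (simp add: u_def o_def)
      show "v \<noteq> 0" using v by auto
    qed (simp add: gG ge)
    then have "ideal_point v = point_at_infinity G"
      unfolding point_at_infinity_def using unique by (simp add: the1_equality)
    then show ?thesis using v by (auto simp: o_def)
  qed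
  obtain v0 where v0: "norm v0 = 1" "ideal_point v0 = point_at_infinity G"
    using subseq[of "\<lambda>n. a + real n"] by auto
  have near: "\<forall>\<^sub>F r in at_top. dist (u r) v0 < e \<or> dist (u r) (- v0) < e" if "0 < e" for e
  proof (rule ccontr)
    assume neg: "\<not> ?thesis"
    have "\<exists>r\<ge>a + real n. \<not> (dist (u r) v0 < e \<or> dist (u r) (- v0) < e)" for n
      using neg unfolding eventually_at_top_linorder by blast
    then obtain \<rho> where \<rho>: "\<And>n. a + real n \<le> \<rho> n"
      and far: "\<And>n. \<not> (dist (u (\<rho> n)) v0 < e \<or> dist (u (\<rho> n)) (- v0) < e)" by metis
    obtain v \<sigma> where v: "norm v = 1" "(\<lambda>n. u (\<rho> (\<sigma> n))) \<longlonglongrightarrow> v" "ideal_point v = point_at_infinity G"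
      using subseq[OF \<rho>] by blast
    then have "v = v0 \<or> v = - v0" using ideal_point_eq_imp v0 by simp
    moreover have "\<forall>\<^sub>F n in sequentially. dist (u (\<rho> (\<sigma> n))) v < e"
      using v(2) \<open>0 < e\<close> by (rule tendstoD)
    ultimately show False using far eventually_happens'[OF sequentially_bot] by blast
  qed
  \<comment> \<open>The balls of radius \<open>1\<close> around \<open>v0\<close> and \<open>- v0\<close> are disjoint.\<close>
  obtain r1 where r1: "a \<le> r1" "\<And>r. r1 \<le> r \<Longrightarrow> dist (u r) v0 < 1 \<or> dist (u r) (- v0) < 1"
  proof -
    obtain r0 where "\<And>r. r0 \<le> r \<Longrightarrow> dist (u r) v0 < 1 \<or> dist (u r) (- v0) < 1"
      using near[of 1] by (auto simp: eventually_at_top_linorder)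
    then show ?thesis by (intro that[of "max a r0"]) auto
  qed
  have far: "2 \<le> dist x v0 + dist x (- v0)" for x
  proof -
    have "2 * v0 = (x + v0) - (x - v0)" by simp
    then have "norm (2 * v0) \<le> norm (x + v0) + norm (x - v0)"
      using norm_triangle_ineq4[of "x + v0" "x - v0"] by (simp only:)
    then show ?thesis using v0(1) by (simp add: dist_norm norm_mult)
  qed
  have conn: "connected (u ` {r1..})"
  proof (rule connected_continuous_image)
    show "continuous_on {r1..} u"
      unfolding u_def using r1 a by (intro continuous_intros continuous_on_subset[OF gc]) auto
  qed auto
  have "u ` {r1..} \<subseteq> ball v0 1 \<or> u ` {r1..} \<subseteq> ball (- v0) 1"
  proof (rule ccontr)
    assume neg: "\<not> ?thesis"
    have "ball v0 1 \<inter> ball (- v0) 1 \<inter> u ` {r1..} = {}"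
    proof -
      have "\<not> (dist v0 x < 1 \<and> dist (- v0) x < 1)" for x
        using far[of x] by (auto simp: dist_commute[of x])
      then show ?thesis by auto
    qed
    moreover have "u ` {r1..} \<subseteq> ball v0 1 \<union> ball (- v0) 1"
      using r1(2) by (fastforce simp: dist_commute[of v0] dist_commute[of "- v0"])
    ultimately show False
      using connectedD[OF conn open_ball open_ball, of v0 1 "- v0" 1] neg by blast
  qed
  then obtain v where v: "v = v0 \<or> v = - v0" "\<And>r. r1 \<le> r \<Longrightarrow> dist (u r) v < 1"
    by (auto simp: subset_iff dist_commute[of v0] dist_commute[of "- v0"])
  have "(u \<longlongrightarrow> v) at_top"
  proof (rule tendstoI)
    fix e :: real assume "0 < e"
    have "\<forall>\<^sub>F r in at_top. dist (u r) v0 < min e 1 \<or> dist (u r) (- v0) < min e 1"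
      using \<open>0 < e\<close> by (intro near) auto
    then show "\<forall>\<^sub>F r in at_top. dist (u r) v < e"
      using eventually_ge_at_top[of r1]
    proof eventually_elim
      case (elim r)
      then show ?case using v(1) v(2)[of r] far[of "u r"] by (cases "v = v0") auto
    qed
  qed
  moreover have "norm v = 1" using v(1) v0 by auto
  moreover have "ideal_point v = point_at_infinity G"
  proof -
    have "ideal_point v \<in> points_at_infinity G"
    proof (rule limit_direction_at_infinity[OF filterlim_ident trivial_limit_at_top_linorder])
      show "((\<lambda>r. g r / of_real r) \<longlongrightarrow> v) at_top" using calculation(1) by (simp add: u_def[abs_def])
      show "v \<noteq> 0" using calculation(2) by auto
      show "\<forall>\<^sub>F r in at_top. plane (g r) \<in> G" using eventually_ge_at_top[of a] by eventually_elim (rule gG)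
    qed
    then show ?thesis unfolding point_at_infinity_def using unique by (simp add: the1_equality)
  qed
  ultimately show ?thesis using that by (simp add: u_def[abs_def])
qed

section \<open>Tangent semi-lines at infinity\<close>

text \<open>
  In homogeneous coordinates a point \<open>(X + iY) v\<close> is \<open>X P + Y Q + E\<close> with \<open>P\<close> representing the point
  at infinity.  In any affine chart at \<open>P\<close> its difference to the image of \<open>P\<close> is, exactly, a
  scalar multiple of \<open>Y m2 + m3\<close> with fixed independent vectors \<open>m2\<close>, \<open>m3\<close>.  The sign of the
  scalar is eventually constant; it is the \<open>k\<close> of the conclusion.  Hence the tangent direction
  depends on the height \<open>Y\<close> only.
\<close>
lemma semi_line_tangent_slope:
  assumes chart: "affine_chart_at A (ideal_point v)" and v: "norm v = 1"
  obtains m2 m3 :: "real^2" and k :: real where "\<bar>k\<bar> = 1"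
    "\<And>x y. x *\<^sub>R m2 + y *\<^sub>R m3 = 0 \<Longrightarrow> x = 0 \<and> y = 0"
    "\<And>a G g u. radial_section a G g \<Longrightarrow> ((\<lambda>r. g r / of_real r) \<longlongrightarrow> v) at_top \<Longrightarrow>
       ((\<lambda>q. sgn (affine_chart A q - affine_chart A (ideal_point v))) \<longlongrightarrow> u)
         (at (ideal_point v) within proj_embed ` G) \<Longrightarrow>
       ((\<lambda>r. sgn (Im (g r / v) *\<^sub>R m2 + m3)) \<longlongrightarrow> k *\<^sub>R u) at_top"
proof -
  have v0: "v \<noteq> 0" using v by auto
  have v2: "(Re v)\<^sup>2 + (Im v)\<^sup>2 = 1" using v by (simp add: cmod_power2[symmetric])
  define P Q E :: "real^3" where "P = vector [Re v, Im v, 0]" and "Q = vector [- Im v, Re v, 0]"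
    and "E = vector [0, 0, 1]"
  define a1 a2 a3 :: "real^3" where "a1 = A *v P" and "a2 = A *v Q" and "a3 = A *v E"
  have self: "proportional w w" if "w \<noteq> 0" for w
    using that by (auto simp: proportional_def intro: exI[of _ 1])
  have P0: "P \<noteq> 0" unfolding P_def using v0 by (rule ideal_vector_nonzero)
  have a13: "a1 $ 3 \<noteq> 0"
    using chart in_chart_domain.abs_eq[OF self[OF P0]]
    by (simp add: affine_chart_at_def ideal_point_def P_def a1_def)
  \<comment> \<open>Up to a factor, the derivative at \<open>a1\<close> of the projection to the affine chart; it kills \<open>a1\<close>.\<close>
  define slope :: "real^3 \<Rightarrow> real^2" where
    "slope b = vector [b $ 1 - a1 $ 1 / a1 $ 3 * b $ 3, b $ 2 - a1 $ 2 / a1 $ 3 * b $ 3]" for b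
  have chart_ideal: "affine_chart A (ideal_point v) = vector [a1 $ 1 / a1 $ 3, a1 $ 2 / a1 $ 3]"
    using affine_chart.abs_eq[OF self[OF P0]] by (simp add: ideal_point_def P_def a1_def)
  have indep: "x = 0 \<and> y = 0" if "x *\<^sub>R slope a2 + y *\<^sub>R slope a3 = 0" for x y
  proof -
    define \<kappa> where "\<kappa> = (x * a2 $ 3 + y * a3 $ 3) / a1 $ 3"
    have "x *\<^sub>R a2 + y *\<^sub>R a3 - \<kappa> *\<^sub>R a1 = 0"
    proof -
      have "x * a2 $ 1 + y * a3 $ 1 - \<kappa> * a1 $ 1 = 0" "x * a2 $ 2 + y * a3 $ 2 - \<kappa> * a1 $ 2 = 0"
        using that by (simp_all add: slope_def \<kappa>_def vec_eq_iff forall_2 algebra_simps add_divide_distrib)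
      moreover have "x * a2 $ 3 + y * a3 $ 3 - \<kappa> * a1 $ 3 = 0"
        using a13 by (simp add: \<kappa>_def)
      ultimately show ?thesis by (simp add: vec_eq_iff forall_3)
    qed
    then have "A *v (x *\<^sub>R Q + y *\<^sub>R E - \<kappa> *\<^sub>R P) = 0"
      by (simp add: a1_def a2_def a3_def matrix_vector_right_distrib
          matrix_vector_mult_diff_distrib matrix_vector_mult_scaleR)
    moreover have "\<exists>B. B ** A = mat 1" using chart by (auto simp: affine_chart_at_def invertible_def)
    ultimately have "x *\<^sub>R Q + y *\<^sub>R E - \<kappa> *\<^sub>R P = 0"
      unfolding matrix_left_invertible_ker by blast
    then have eqs: "x * Im v = - (\<kappa> * Re v)" "x * Re v = \<kappa> * Im v" "y = 0"
      by (simp_all add: P_def Q_def E_def vec_eq_iff forall_3 algebra_simps)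
    have "x = x * ((Re v)\<^sup>2 + (Im v)\<^sup>2)" using v2 by simp
    also have "\<dots> = (x * Re v) * Re v + (x * Im v) * Im v" by (simp add: algebra_simps power2_eq_square)
    also have "\<dots> = 0" unfolding eqs by simp
    finally show ?thesis using eqs by simp
  qed
  have main: "((\<lambda>r. sgn (Im (g r / v) *\<^sub>R slope a2 + slope a3)) \<longlongrightarrow> sgn (a1 $ 3) *\<^sub>R u) at_top"
    if sec: "radial_section a G g" and dir: "((\<lambda>r. g r / of_real r) \<longlongrightarrow> v) at_top"
      and lim: "((\<lambda>q. sgn (affine_chart A q - affine_chart A (ideal_point v))) \<longlongrightarrow> u)
         (at (ideal_point v) within proj_embed ` G)" for a G g u
  proof -
    define X Y where "X r = Re (g r / v)" and "Y r = Im (g r / v)" for r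
    define w where "w r = X r *\<^sub>R P + Y r *\<^sub>R Q + E" for r
    have w: "proj_embed (plane (g r)) = homogeneous (w r)" "w r $ 3 = 1" for r
    proof -
      have "g r = Complex (X r) (Y r) * v" using v0 by (simp add: X_def Y_def)
      then show "proj_embed (plane (g r)) = homogeneous (w r)" "w r $ 3 = 1"
        unfolding proj_embed_def w_def P_def Q_def E_def
        by (auto intro!: arg_cong[of _ _ homogeneous] simp: vec_eq_iff forall_3 algebra_simps)
    qed
    have w0: "w r \<noteq> 0" for r using w(2)[of r] by auto
    define b where "b r = A *v w r" for r
    have b: "b r = X r *\<^sub>R a1 + Y r *\<^sub>R a2 + a3" for r
      by (simp add: b_def w_def a1_def a2_def a3_def matrix_vector_right_distrib matrix_vector_mult_scaleR)
    have "((\<lambda>r. (g r / of_real r) / v) \<longlongrightarrow> v / v) at_top"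
      by (intro tendsto_intros dir v0)
    then have q: "((\<lambda>r. g r / of_real r / v) \<longlongrightarrow> 1) at_top"
      using v0 by simp
    have "X r / r = Re (g r / of_real r / v)" "Y r / r = Im (g r / of_real r / v)" for r
    proof -
      have "g r / of_real r / v = (g r / v) / of_real r" by simp
      then show "X r / r = Re (g r / of_real r / v)" "Y r / r = Im (g r / of_real r / v)"
        unfolding X_def Y_def by (simp_all only: Re_divide_of_real Im_divide_of_real)
    qed
    then have XY: "((\<lambda>r. X r / r) \<longlongrightarrow> 1) at_top" "((\<lambda>r. Y r / r) \<longlongrightarrow> 0) at_top"
      using tendsto_Re[OF q] tendsto_Im[OF q] by (simp_all only: one_complex.sel)
    have "((\<lambda>r. X r / r * a1 $ 3 + Y r / r * a2 $ 3 + a3 $ 3 * inverse r) \<longlongrightarrow> 1 * a1 $ 3 + 0 * a2 $ 3 + a3 $ 3 * 0) at_top"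
      by (intro tendsto_intros XY tendsto_inverse_0_at_top filterlim_ident)
    then have "((\<lambda>r. b r $ 3 / r) \<longlongrightarrow> a1 $ 3) at_top"
      by (simp add: b divide_inverse algebra_simps)
    then have "((\<lambda>r. sgn (b r $ 3 / r)) \<longlongrightarrow> sgn (a1 $ 3)) at_top"
      using a13 by (rule tendsto_sgn)
    then have "\<forall>\<^sub>F r in at_top. dist (sgn (b r $ 3 / r)) (sgn (a1 $ 3)) < 1"
      by (rule tendstoD) simp
    then have sgn_b: "\<forall>\<^sub>F r in at_top. sgn (b r $ 3) = sgn (a1 $ 3)"
      using eventually_gt_at_top[of 0]
    proof eventually_elim
      case (elim r)
      then have "\<bar>sgn (b r $ 3) - sgn (a1 $ 3)\<bar> < 1" by (simp add: dist_real_def sgn_divide)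
      then show ?case using a13 by (auto simp: sgn_if split: if_splits)
    qed
    have not_ideal: "proj_embed (plane (g r)) \<noteq> ideal_point v" for r
    proof
      assume "proj_embed (plane (g r)) = ideal_point v"
      then have "proportional (w r) P"
        unfolding w ideal_point_def P_def[symmetric] homogeneous_eq_iff[OF w0 P0] .
      then obtain c where "w r = c *\<^sub>R P" by (auto simp: proportional_def)
      then show False using w(2)[of r] by (simp add: P_def)
    qed
    have "filterlim (\<lambda>r. proj_embed (plane (g r))) (at (ideal_point v) within proj_embed ` G) at_top"
      unfolding filterlim_at
    proof
      show "\<forall>\<^sub>F r in at_top. proj_embed (plane (g r)) \<in> proj_embed ` G \<and> proj_embed (plane (g r)) \<noteq> ideal_point v"
        using eventually_ge_at_top[of a] by eventually_elim (use sec not_ideal in \<open>auto simp: radial_section_def\<close>)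
      show "((\<lambda>r. proj_embed (plane (g r))) \<longlongrightarrow> ideal_point v) at_top"
        by (rule tendsto_proj_embed_ideal_point[OF filterlim_ident dir v0])
    qed
    from filterlim_compose[OF lim this]
    have "((\<lambda>r. sgn (a1 $ 3) *\<^sub>R sgn (affine_chart A (proj_embed (plane (g r))) - affine_chart A (ideal_point v)))
        \<longlongrightarrow> sgn (a1 $ 3) *\<^sub>R u) at_top"
      by (intro tendsto_intros)
    moreover have "\<forall>\<^sub>F r in at_top. sgn (a1 $ 3) *\<^sub>R sgn (affine_chart A (proj_embed (plane (g r))) - affine_chart A (ideal_point v))
       = sgn (Y r *\<^sub>R slope a2 + slope a3)"
      using sgn_b
    proof eventually_elim
      case (elim r)
      have b3: "b r $ 3 \<noteq> 0" using elim a13 by (metis sgn_eq_0_iff)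
      have "affine_chart A (proj_embed (plane (g r))) = vector [b r $ 1 / b r $ 3, b r $ 2 / b r $ 3]"
        unfolding w using affine_chart.abs_eq[OF self[OF w0]] by (simp add: b_def)
      then have "affine_chart A (proj_embed (plane (g r))) - affine_chart A (ideal_point v)
          = (1 / b r $ 3) *\<^sub>R slope (b r)"
        unfolding chart_ideal slope_def using a13 b3 by (simp add: vec_eq_iff forall_2 field_simps)
      also have "slope (b r) = Y r *\<^sub>R slope a2 + slope a3"
        unfolding slope_def b using a13 by (simp add: vec_eq_iff forall_2 field_simps)
      finally have "sgn (affine_chart A (proj_embed (plane (g r))) - affine_chart A (ideal_point v))
          = sgn (a1 $ 3) *\<^sub>R sgn (Y r *\<^sub>R slope a2 + slope a3)"
        using elim by (simp add: sgn_scaleR sgn_divide)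
      moreover have "sgn (a1 $ 3) * sgn (a1 $ 3) = 1" using a13 by (simp add: sgn_if)
      ultimately show ?case by simp
    qed
    ultimately have "((\<lambda>r. sgn (Y r *\<^sub>R slope a2 + slope a3)) \<longlongrightarrow> sgn (a1 $ 3) *\<^sub>R u) at_top"
      by (rule Lim_transform_eventually)
    then show ?thesis by (simp add: Y_def)
  qed
  show ?thesis
    using that[of "sgn (a1 $ 3)" "slope a2" "slope a3"] indep main a13 by (simp add: abs_sgn_eq)
qed

text \<open>
  A linear change of coordinates sends \<open>Y m2 + m3\<close> to \<open>(Y, 1)\<close>, so \<open>Y / sqrt (1 + Y\<^sup>2)\<close>
  converges.  Its limit in \<open>[-1, 1]\<close> determines the limit direction, because the latter is a unit
  vector in the closed upper half-plane; so the two limits differ, and any height with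
  value strictly between them eventually separates \<open>Y\<close> from \<open>Y'\<close>.
\<close>
lemma slope_tangents_separate:
  fixes m2 m3 u u' :: "real^2" and Y Y' :: "real \<Rightarrow> real"
  assumes indep: "\<And>x y. x *\<^sub>R m2 + y *\<^sub>R m3 = 0 \<Longrightarrow> x = 0 \<and> y = 0"
    and lim: "((\<lambda>r. sgn (Y r *\<^sub>R m2 + m3)) \<longlongrightarrow> u) at_top" "norm u = 1"
    and lim': "((\<lambda>r. sgn (Y' r *\<^sub>R m2 + m3)) \<longlongrightarrow> u') at_top" "norm u' = 1"
    and "u \<noteq> u'"
  obtains c1 c2 :: real where "c1 < c2"
    "(\<forall>c. c1 < c \<longrightarrow> c < c2 \<longrightarrow> (\<forall>\<^sub>F r in at_top. Y r < c \<and> c < Y' r)) \<or>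
     (\<forall>c. c1 < c \<longrightarrow> c < c2 \<longrightarrow> (\<forall>\<^sub>F r in at_top. Y' r < c \<and> c < Y r))"
proof -
  define L where "L w = (w $ 1) *\<^sub>R m2 + (w $ 2) *\<^sub>R m3" for w :: "real^2"
  have L: "linear L"
    by (rule linearI) (simp_all add: L_def scaleR_add_left scaleR_add_right add_ac)
  have "inj L"
    unfolding linear_injective_0[OF L]
  proof (intro allI impI)
    fix w assume "L w = 0"
    then have "w $ 1 = 0 \<and> w $ 2 = 0" unfolding L_def by (rule indep)
    then show "w = 0" by (simp add: vec_eq_iff forall_2)
  qed
  then obtain J where J: "linear J" "\<And>w. J (L w) = w" "\<And>w. L (J w) = w"
    using linear_injective_isomorphism[OF L] by metis
  have sgn_scale: "sgn (k *\<^sub>R w) = sgn w" if "0 < k" for k and w :: "real^2"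
    using that by (simp add: sgn_scaleR)
  have slope: "((\<lambda>r. sgn (vector [y r, 1] :: real^2)) \<longlongrightarrow> sgn (J w)) at_top \<and> norm (sgn (J w)) = 1 \<and>
      0 \<le> sgn (J w) $ 2 \<and> w = sgn (L (sgn (J w)))"
    if yw: "((\<lambda>r. sgn (y r *\<^sub>R m2 + m3)) \<longlongrightarrow> w) at_top" "norm w = 1" for y :: "real \<Rightarrow> real" and w :: "real^2"
  proof -
    have "w \<noteq> 0" using yw by auto
    then have Jw: "J w \<noteq> 0" using J(3)[of w] linear_0[OF L] by auto
    have "sgn (J (sgn (y r *\<^sub>R m2 + m3))) = sgn (vector [y r, 1])" for r
    proof -
      have yL: "y r *\<^sub>R m2 + m3 = L (vector [y r, 1])" by (simp add: L_def)
      have "y r *\<^sub>R m2 + m3 \<noteq> 0" using indep[where x="y r" and y=1] by auto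
      then show ?thesis
        unfolding sgn_div_norm[of "y r *\<^sub>R m2 + m3"] using J
        by (simp add: linear_cmul sgn_scale yL)
    qed
    moreover have "((\<lambda>r. sgn (J (sgn (y r *\<^sub>R m2 + m3)))) \<longlongrightarrow> sgn (J w)) at_top"
      using J(1) by (intro tendsto_sgn Jw bounded_linear.tendsto[OF _ yw(1)]) (simp add: linear_conv_bounded_linear)
    ultimately have lim: "((\<lambda>r. sgn (vector [y r, 1] :: real^2)) \<longlongrightarrow> sgn (J w)) at_top" by simp
    have "((\<lambda>r. sgn (vector [y r, 1] :: real^2) $ 2) \<longlongrightarrow> sgn (J w) $ 2) at_top"
      by (intro tendsto_vec_nth lim)
    then have "0 \<le> sgn (J w) $ 2"
      by (rule tendsto_lowerbound) (simp_all add: sgn_div_norm)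
    moreover have "w = sgn (L (sgn (J w)))"
    proof -
      have "L (sgn (J w)) = inverse (norm (J w)) *\<^sub>R w"
        unfolding sgn_div_norm using linear_cmul[OF L] J(3) by simp
      then have "sgn (L (sgn (J w))) = sgn w" using Jw by (simp only: sgn_scale) (simp add: sgn_scale)
      also have "\<dots> = w" using yw(2) by (simp add: sgn_div_norm)
      finally show ?thesis by simp
    qed
    ultimately show ?thesis using lim Jw by (simp add: norm_sgn)
  qed
  define h where "h y = sgn (vector [y, 1] :: real^2) $ 1" for y
  have h: "h y = y / sqrt (1 + y\<^sup>2)" for y
    by (simp add: h_def sgn_div_norm norm_vec_def L2_set_def sum_2 divide_inverse add.commute mult.commute)
  have h_less: "h x < h y \<longleftrightarrow> x < y" for x y
  proof -
    have "strict_mono h"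
    proof (rule strict_monoI)
      fix x y :: real assume "x < y"
      then show "h x < h y"
      proof (rule DERIV_pos_imp_increasing)
        fix z :: real
        have "1 + z\<^sup>2 > 0" by (simp add: add_pos_nonneg)
        then have "((\<lambda>y. y / sqrt (1 + y\<^sup>2)) has_real_derivative
            (sqrt (1 + z\<^sup>2) - z * (z / sqrt (1 + z\<^sup>2))) / (1 + z\<^sup>2)) (at z)"
          by (auto intro!: derivative_eq_intros simp: field_simps)
        moreover have "(sqrt (1 + z\<^sup>2) - z * (z / sqrt (1 + z\<^sup>2))) / (1 + z\<^sup>2) > 0"
        proof -
          define S where "S = sqrt (1 + z\<^sup>2)"
          have S: "S > 0" "S * S = 1 + z * z"
            using \<open>1 + z\<^sup>2 > 0\<close> by (simp_all add: S_def power2_eq_square)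
          then have "S - z * (z / S) = 1 / S" by (simp add: field_simps)
          then show ?thesis using S(1) \<open>1 + z\<^sup>2 > 0\<close> by (simp flip: S_def)
        qed
        ultimately show "\<exists>D. (h has_real_derivative D) (at z) \<and> D > 0"
          unfolding h by blast
      qed
    qed
    then show ?thesis by (rule strict_mono_less)
  qed
  have hlim: "((\<lambda>r. h (Y r)) \<longlongrightarrow> sgn (J u) $ 1) at_top" "((\<lambda>r. h (Y' r)) \<longlongrightarrow> sgn (J u') $ 1) at_top"
    unfolding h_def using slope[OF lim] slope[OF lim'] by (auto intro: tendsto_vec_nth)
  have neq: "sgn (J u) $ 1 \<noteq> sgn (J u') $ 1"
  proof
    assume eq: "sgn (J u) $ 1 = sgn (J u') $ 1"
    have unit: "(w $ 1)\<^sup>2 + (w $ 2)\<^sup>2 = 1" if "norm w = 1" for w :: "real^2"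
      using that by (simp add: norm_vec_def L2_set_def sum_2)
    have "(sgn (J u) $ 1)\<^sup>2 + (sgn (J u) $ 2)\<^sup>2 = 1" "(sgn (J u') $ 1)\<^sup>2 + (sgn (J u') $ 2)\<^sup>2 = 1"
      using unit slope[OF lim] slope[OF lim'] by blast+
    then have "(sgn (J u) $ 2)\<^sup>2 = (sgn (J u') $ 2)\<^sup>2"
      unfolding eq by linarith
    then have "sgn (J u) $ 2 = sgn (J u') $ 2"
      using slope[OF lim] slope[OF lim'] by (simp add: power2_eq_iff_nonneg)
    then have "sgn (J u) = sgn (J u')" using eq by (simp add: vec_eq_iff forall_2)
    then have "u = u'" using slope[OF lim] slope[OF lim'] by metis
    then show False using \<open>u \<noteq> u'\<close> by simp
  qed
  have gap: "\<exists>c1 c2. c1 < c2 \<and> (\<forall>c. c1 < c \<longrightarrow> c < c2 \<longrightarrow> a < h c \<and> h c < b)"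
    if "a < b" "-1 \<le> a" "b \<le> 1" for a b
  proof -
    \<comment> \<open>The inverse of \<open>h\<close> on the open interval \<open>(-1, 1)\<close>.\<close>
    define g where "g t = t / sqrt (1 - t\<^sup>2)" for t
    have hg: "h (g t) = t" if "\<bar>t\<bar> < 1" for t
    proof -
      have "1 - t\<^sup>2 > 0" using that by (simp add: abs_square_less_1)
      then have "1 + (g t)\<^sup>2 = 1 / (1 - t\<^sup>2)" by (simp add: g_def power_divide field_simps)
      then show ?thesis using \<open>1 - t\<^sup>2 > 0\<close> by (simp add: h real_sqrt_divide) (simp add: g_def)
    qed
    define t1 t2 where "t1 = a + (b - a) / 3" and "t2 = a + 2 * (b - a) / 3"
    have t: "a < t1" "t1 < t2" "t2 < b" "\<bar>t1\<bar> < 1" "\<bar>t2\<bar> < 1"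
      using that by (auto simp: t1_def t2_def field_simps abs_less_iff)
    have "a < h c \<and> h c < b" if "g t1 < c" "c < g t2" for c
      using that t hg h_less[of "g t1" c] h_less[of c "g t2"] by auto
    moreover have "g t1 < g t2" using t hg h_less[of "g t1" "g t2"] by simp
    ultimately show ?thesis by blast
  qed
  have ordered: "\<exists>c1 c2. c1 < c2 \<and> (\<forall>c. c1 < c \<longrightarrow> c < c2 \<longrightarrow> (\<forall>\<^sub>F r in at_top. y r < c \<and> c < y' r))"
    if "((\<lambda>r. h (y r)) \<longlongrightarrow> a) at_top" "((\<lambda>r. h (y' r)) \<longlongrightarrow> b) at_top"
      and ab: "a < b" "-1 \<le> a" "b \<le> 1"
    for y y' :: "real \<Rightarrow> real" and a b
  proof -
    obtain c1 c2 where c: "c1 < c2" "\<And>c. c1 < c \<Longrightarrow> c < c2 \<Longrightarrow> a < h c \<and> h c < b"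
      using gap[OF ab] by blast
    have "\<forall>\<^sub>F r in at_top. y r < c \<and> c < y' r" if "c1 < c" "c < c2" for c
      using order_tendstoD(2)[OF \<open>((\<lambda>r. h (y r)) \<longlongrightarrow> a) at_top\<close>, of "h c"]
        order_tendstoD(1)[OF \<open>((\<lambda>r. h (y' r)) \<longlongrightarrow> b) at_top\<close>, of "h c"] c(2)[OF that]
      by (simp add: h_less eventually_conj_iff)
    then show ?thesis using c(1) by blast
  qed
  have "\<bar>sgn (J w) $ 1\<bar> \<le> 1" for w
    using component_le_norm_cart[of "sgn (J w)" 1] norm_sgn[of "J w"] by (auto split: if_splits)
  then have bounds: "-1 \<le> sgn (J w) $ 1" "sgn (J w) $ 1 \<le> 1" for w by (auto simp: abs_le_iff minus_le_iff)
  from neq consider "sgn (J u) $ 1 < sgn (J u') $ 1" | "sgn (J u') $ 1 < sgn (J u) $ 1" by linarith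
  then show ?thesis
  proof cases
    case 1 then show ?thesis using ordered[OF hlim] bounds that by blast
  next
    case 2 then show ?thesis using ordered[OF hlim(2,1)] bounds that by blast
  qed
qed

lemma tangent_semi_line_unique:
  assumes sec: "radial_section a G g" and v: "norm v = 1" "((\<lambda>r. g r / of_real r) \<longlongrightarrow> v) at_top"
  shows "\<not> tangent_to_different_semi_lines (ideal_point v) G G"
proof
  assume "tangent_to_different_semi_lines (ideal_point v) G G"
  then obtain A H H' where A: "affine_chart_at A (ideal_point v)" and "H \<noteq> H'"
    and H: "tangent_to_semi_line A (ideal_point v) G H" "tangent_to_semi_line A (ideal_point v) G H'"
    by (auto simp: tangent_to_different_semi_lines_def)
  obtain u where u: "H = {affine_chart A (ideal_point v) + t *\<^sub>R u | t. t \<ge> 0}"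
    "((\<lambda>q. sgn (affine_chart A q - affine_chart A (ideal_point v))) \<longlongrightarrow> u) (at (ideal_point v) within proj_embed ` G)"
    using H(1) unfolding tangent_to_semi_line_def by blast
  obtain u' where u': "H' = {affine_chart A (ideal_point v) + t *\<^sub>R u' | t. t \<ge> 0}"
    "((\<lambda>q. sgn (affine_chart A q - affine_chart A (ideal_point v))) \<longlongrightarrow> u') (at (ideal_point v) within proj_embed ` G)"
    using H(2) unfolding tangent_to_semi_line_def by blast
  show False
  proof (rule semi_line_tangent_slope[OF A v(1)])
    fix m2 m3 :: "real^2" and k :: real
    assume k: "\<bar>k\<bar> = 1"
      and lim: "\<And>a G g u. radial_section a G g \<Longrightarrow> ((\<lambda>r. g r / of_real r) \<longlongrightarrow> v) at_top \<Longrightarrow>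
       ((\<lambda>q. sgn (affine_chart A q - affine_chart A (ideal_point v))) \<longlongrightarrow> u)
         (at (ideal_point v) within proj_embed ` G) \<Longrightarrow>
       ((\<lambda>r. sgn (Im (g r / v) *\<^sub>R m2 + m3)) \<longlongrightarrow> k *\<^sub>R u) at_top"
    have "k *\<^sub>R u = k *\<^sub>R u'"
      using lim[OF sec v(2) u(2)] lim[OF sec v(2) u'(2)] by (rule tendsto_unique[OF trivial_limit_at_top_linorder])
    then have "u = u'" using k by auto
    then show False using u u' \<open>H \<noteq> H'\<close> by simp
  qed
qed

section \<open>Critical points on circles\<close>

text \<open>
  The Jacobian determinant of \<open>(f, \<rho>)\<close> is, up to the factor \<open>-2\<close>, the derivative of \<open>f\<close> along the
  tangent \<open>\<i> z\<close> of the circle through \<open>z\<close>.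
\<close>
lemma mem_milnor_set_iff:
  assumes f: "(f has_derivative f') (at (plane z))"
  shows "plane z \<in> milnor_set f 0 \<longleftrightarrow> f' (plane (\<i> * z)) = 0"
proof -
  have vec2: "(vector [x, y] :: real^2) = x *\<^sub>R axis 1 1 + y *\<^sub>R axis 2 1" for x y
    by (simp add: vec_eq_iff forall_2 axis_def)
  have lin: "linear f'" using f by (rule has_derivative_linear)
  let ?D = "\<lambda>h::real^2. vector [f' h, 2 * (Re z * h $ 1 + Im z * h $ 2)] :: real^2"
  have coord: "((\<lambda>y::real^2. y $ i) has_derivative (\<lambda>h. h $ i)) (at (plane z))" for i
    by (rule bounded_linear_imp_has_derivative[OF bounded_linear_vec_nth])
  have square: "((\<lambda>y::real^2. (y $ 1)\<^sup>2 + (y $ 2)\<^sup>2) has_derivative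
      (\<lambda>h. 2 * (Re z * h $ 1 + Im z * h $ 2))) (at (plane z))"
    unfolding power2_eq_square
    by (rule has_derivative_eq_rhs[OF has_derivative_add[OF
          has_derivative_mult[OF coord coord] has_derivative_mult[OF coord coord]]])
      (simp add: fun_eq_iff)
  have "((\<lambda>y::real^2. f y *\<^sub>R axis 1 1 + ((y $ 1)\<^sup>2 + (y $ 2)\<^sup>2) *\<^sub>R axis 2 1 :: real^2) has_derivative
      (\<lambda>h. f' h *\<^sub>R axis 1 1 + (2 * (Re z * h $ 1 + Im z * h $ 2)) *\<^sub>R axis 2 1)) (at (plane z))"
    by (rule has_derivative_add[OF has_derivative_scaleR_left[OF f] has_derivative_scaleR_left[OF square]])
  then have "((\<lambda>y. vector [f y, rho 0 y] :: real^2) has_derivative ?D) (at (plane z))"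
    by (simp only: vec2 rho_def zero_index diff_zero)
  then have "frechet_derivative (\<lambda>y. vector [f y, rho 0 y] :: real^2) (at (plane z)) = ?D"
    by (rule frechet_derivative_at[symmetric])
  then have "det (jacobian (\<lambda>y. vector [f y, rho 0 y] :: real^2) (at (plane z)))
      = 2 * (Im z * f' (axis 1 1) - Re z * f' (axis 2 1))"
    by (simp add: jacobian_def det_2 matrix_def axis_def algebra_simps)
  moreover have "f' (plane (\<i> * z)) = Re z * f' (axis 2 1) - Im z * f' (axis 1 1)"
  proof -
    have "plane (\<i> * z) = Re z *\<^sub>R axis 2 1 - Im z *\<^sub>R axis 1 1"
      by (simp add: vec_eq_iff forall_2 axis_def)
    then show ?thesis using lin by (simp add: linear_diff linear_cmul)
  qed
  ultimately show ?thesis by (auto simp: milnor_set_def)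
qed

text \<open>
  The derivative vanishes along \<open>v\<close>.  Off the line orthogonal to \<open>v\<close> the tangent of the circle is
  not parallel to \<open>v\<close>, so a critical point along the circle has vanishing derivative.
\<close>
lemma translation_invariant_imp_critical:
  fixes F :: "complex \<Rightarrow> real"
  assumes F: "\<And>z. (F has_derivative F' z) (at z)"
    and invariant: "\<And>z t. F (z + t *\<^sub>R v) = F z"
    and v: "v \<noteq> 0" and crit: "F' z (\<i> * z) = 0" and Re: "0 < Re (z / v)"
  shows "F' z = (\<lambda>_. 0)"
proof -
  have lin: "linear (F' z)" using F by (rule has_derivative_linear)
  have c: "((\<lambda>t::real. z + t *\<^sub>R v) has_derivative (\<lambda>t. t *\<^sub>R v)) (at 0)"
    by (auto intro!: derivative_eq_intros)
  have "((\<lambda>t::real. F (z + t *\<^sub>R v)) has_derivative (\<lambda>t. F' z (t *\<^sub>R v))) (at 0)"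
    using has_derivative_compose[OF c, of F "F' z"] F[of z] by simp
  then have "((\<lambda>t::real. F z) has_derivative (\<lambda>t. F' z (t *\<^sub>R v))) (at 0)"
    by (simp add: invariant)
  then have "(\<lambda>t. F' z (t *\<^sub>R v)) = (\<lambda>t::real. 0)"
    using has_derivative_unique has_derivative_const by blast
  then have "F' z (1 *\<^sub>R v) = 0" by metis
  then have v': "F' z v = 0" by simp
  have expand: "F' z h = Im (h / v) * F' z (\<i> * v)" for h
  proof -
    have "h = Re (h / v) *\<^sub>R v + Im (h / v) *\<^sub>R (\<i> * v)"
    proof -
      have "h = Complex (Re (h / v)) (Im (h / v)) * v" using v by simp
      then show ?thesis by (simp only: Complex_times_eq)
    qed
    then have "F' z h = F' z (Re (h / v) *\<^sub>R v + Im (h / v) *\<^sub>R (\<i> * v))"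
      by (rule arg_cong)
    then show ?thesis
      by (simp only: linear_add[OF lin] linear_cmul[OF lin] v' scaleR_zero_right add_0 real_scaleR_def)
  qed
  have "Im (\<i> * z / v) = Re (z / v)"
    using Im_i_times[of "z / v"] by simp
  then have "F' z (\<i> * v) = 0" using expand[of "\<i> * z"] crit Re by simp
  then have "F' z h = 0" for h using expand[of h] by simp
  then show ?thesis by (rule ext)
qed

text \<open>
  The arc \<open>G'\<close> is the first one met from \<open>G\<close>, so the interior of the sector meets the Milnor set in
  singular points only.
\<close>
lemma immediate_successor_sector:
  assumes succ: "immediate_successor f R G G'" and "0 \<le> R"
    and "radial_section a G g" "radial_section a G' d" "G \<noteq> G'"
  obtains b where "a \<le> b" "R < b" "\<And>r. b \<le> r \<Longrightarrow> g r \<noteq> d r"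
    "\<And>z. b \<le> norm z \<Longrightarrow> z \<in> open_sector g d \<Longrightarrow> plane z \<in> milnor_set f 0 \<Longrightarrow> plane z \<in> sing f"
proof -
  have g: "0 < a" "\<And>r. a \<le> r \<Longrightarrow> norm (g r) = r" "\<And>r. a \<le> r \<Longrightarrow> plane (g r) \<in> G"
    "\<And>z. a \<le> norm z \<Longrightarrow> plane z \<in> G \<Longrightarrow> g (norm z) = z"
    and d: "\<And>r. a \<le> r \<Longrightarrow> plane (d r) \<in> G'"
    "\<And>z. a \<le> norm z \<Longrightarrow> plane z \<in> G' \<Longrightarrow> d (norm z) = z"
    using assms(3,4) by (auto simp: radial_section_def)
  have arcs: "G \<in> milnor_arcs f 0 R" "G' \<in> milnor_arcs f 0 R"
    using succ by (auto simp: immediate_successor_def)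
  have "G \<inter> G' = {}"
    using components_nonoverlap[of G _ G'] arcs \<open>G \<noteq> G'\<close> by (auto simp: milnor_arcs_def)
  then have neq: "g r \<noteq> d r" if "a \<le> r" for r
    using g(3)[OF that] d(1)[OF that] by auto
  obtain b0 where b0: "\<And>r. b0 \<le> r \<Longrightarrow> \<exists>x\<in>G. norm x = r \<and> (\<exists>\<theta>. 0 < \<theta> \<and> \<theta> \<le> 2 * pi \<and>
      rotate_ccw \<theta> x \<in> G' \<and> (\<forall>\<psi>. 0 < \<psi> \<and> \<psi> < \<theta> \<longrightarrow> rotate_ccw \<psi> x \<notin> \<Union>(milnor_arcs f 0 R)))"
    using succ unfolding immediate_successor_def eventually_at_top_linorder by blast
  define b where "b = max b0 (max a (R + 1))"
  have free: "plane z \<in> sing f"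
    if z: "b \<le> norm z" "z \<in> open_sector g d" "plane z \<in> milnor_set f 0" for z
  proof -
    define r where "r = norm z"
    have r: "b0 \<le> r" "a \<le> r" "R < r" using z by (auto simp: b_def r_def)
    from b0[OF r(1)] obtain x \<theta> where x: "x \<in> G" "norm x = r" and \<theta>: "0 < \<theta>" "\<theta> \<le> 2 * pi"
      "rotate_ccw \<theta> x \<in> G'" and none: "\<And>\<psi>. 0 < \<psi> \<Longrightarrow> \<psi> < \<theta> \<Longrightarrow> rotate_ccw \<psi> x \<notin> \<Union>(milnor_arcs f 0 R)"
      by blast
    define w where "w = Complex (x $ 1) (x $ 2)"
    have xw: "x = plane w" by (simp add: w_def)
    then have w: "g r = w" using g(4)[of w] x r by simp
    then have dr: "d r = cis \<theta> * g r"
      using d(2)[of "cis \<theta> * w"] \<theta>(3) x r xw by (simp add: rotate_ccw_plane norm_mult)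
    \<comment> \<open>The definition of the successor allows a full turn, which would put \<open>d r\<close> on \<open>G\<close>.\<close>
    have "\<theta> \<noteq> 2 * pi" using dr neq[OF r(2)] by auto
    then have "\<theta> < 2 * pi" using \<theta> by simp
    have "g r \<noteq> 0" using g(2)[OF r(2)] r(2) g(1) by auto
    then have Arg: "Arg2pi (d r / g r) = \<theta>"
      using dr \<theta> \<open>\<theta> < 2 * pi\<close> by (simp add: Arg2pi_cis)
    define \<psi> where "\<psi> = Arg2pi (z / g r)"
    have "0 < \<psi>" "\<psi> < \<theta>" using z(2) Arg by (simp_all add: open_sector_def \<psi>_def r_def)
    moreover have "z = g r * cis \<psi>"
      unfolding \<psi>_def using r(2) g(1,2) by (intro Arg2pi_quotient_cis) (auto simp: r_def)
    then have "rotate_ccw \<psi> x = plane z"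
      using xw w by (simp add: rotate_ccw_plane mult.commute)
    ultimately have "plane z \<notin> \<Union>(milnor_arcs f 0 R)" using none by metis
    then have "plane z \<notin> milnor_set f 0 - (cball 0 R \<union> sing f)"
      unfolding milnor_arcs_def Union_components by simp
    then show ?thesis using z(3) r by (simp add: r_def)
  qed
  show ?thesis
    by (rule that[of b]) (use neq free in \<open>auto simp: b_def\<close>)
qed

section \<open>Consecutive arcs with finite limits\<close>

text \<open>
  The core of the argument: \<open>f\<close> is bounded on the sector between the arcs, and the sector is
  either wide or contains a strip parallel to the common direction.
\<close>
lemma bounded_consecutive_arcs_imp_False:
  fixes f :: "real^2 \<Rightarrow> real"
  assumes poly: "real_polynomial_function f" and nonconst: "\<not> f constant_on UNIV" and "0 \<le> R"
    and succ: "immediate_successor f R G G'" and "G \<noteq> G'"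
    and sec: "radial_section a0 G g" "radial_section a0 G' d"
    and bounded: "\<And>r. a0 \<le> r \<Longrightarrow> \<bar>f (plane (g r))\<bar> \<le> B" "\<And>r. a0 \<le> r \<Longrightarrow> \<bar>f (plane (d r))\<bar> \<le> B"
    and dir: "norm v = 1" "((\<lambda>r. g r / of_real r) \<longlongrightarrow> v) at_top"
      "norm v' = 1" "((\<lambda>r. d r / of_real r) \<longlongrightarrow> v') at_top"
    and differ: "v \<noteq> v' \<or> tangent_to_different_semi_lines (ideal_point v) G G'"
  shows False
proof -
  obtain a where a: "a0 \<le> a" "R < a" and neq: "\<And>r. a \<le> r \<Longrightarrow> g r \<noteq> d r"
    and free: "\<And>z. a \<le> norm z \<Longrightarrow> z \<in> open_sector g d \<Longrightarrow> plane z \<in> milnor_set f 0 \<Longrightarrow> plane z \<in> sing f"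
    using immediate_successor_sector[OF succ \<open>0 \<le> R\<close> sec \<open>G \<noteq> G'\<close>] by blast
  have "0 < a" using a \<open>0 \<le> R\<close> by simp
  have g: "continuous_on {a..} g" "\<And>r. a \<le> r \<Longrightarrow> norm (g r) = r" "\<And>r. a \<le> r \<Longrightarrow> plane (g r) \<in> G"
    and d: "continuous_on {a..} d" "\<And>r. a \<le> r \<Longrightarrow> norm (d r) = r"
    using radial_section_mono[OF sec(1) a(1)] radial_section_mono[OF sec(2) a(1)]
    by (auto simp: radial_section_def)
  define F where "F z = f (plane z)" for z
  define F' where "F' z h = frechet_derivative f (at (plane z)) (plane h)" for z h
  have f: "(f has_derivative frechet_derivative f (at x)) (at x)" for x
    using differentiable_at_real_polynomial_function[OF poly] frechet_derivative_works by blast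
  have polyF: "real_polynomial_function F"
    unfolding F_def using real_polynomial_function_compose[OF polynomial_function_bounded_linear[OF bounded_linear_plane] poly]
    by (simp add: o_def)
  have F: "(F has_derivative F' z) (at z)" for z
    unfolding F_def F'_def
    by (rule has_derivative_compose[OF bounded_linear_imp_has_derivative[OF bounded_linear_plane] f])
  have sing_iff: "plane z \<in> sing f \<longleftrightarrow> F' z = (\<lambda>_. 0)" for z
  proof
    assume "plane z \<in> sing f"
    then have "frechet_derivative f (at (plane z)) = (\<lambda>_. 0)"
      using has_derivative_unique[OF f] by (auto simp: sing_def)
    then show "F' z = (\<lambda>_. 0)" by (simp add: F'_def fun_eq_iff)
  next
    assume F0: "F' z = (\<lambda>_. 0)"
    have "frechet_derivative f (at (plane z)) h = 0" for h
      using fun_cong[OF F0, of "Complex (h $ 1) (h $ 2)"] by (simp add: F'_def)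
    then have "frechet_derivative f (at (plane z)) = (\<lambda>_. 0)" by auto
    then show "plane z \<in> sing f" using f[of "plane z"] by (simp add: sing_def)
  qed
  have milnor_iff: "plane z \<in> milnor_set f 0 \<longleftrightarrow> F' z (\<i> * z) = 0" for z
    using mem_milnor_set_iff[OF f] by (simp add: F'_def)
  have nonconstF: "\<not> (\<forall>z. F z = F 0)"
  proof
    assume "\<forall>z. F z = F 0"
    then have "f x = F 0" for x unfolding F_def by (metis plane_Complex)
    then show False using nonconst by (auto simp: constant_on_def)
  qed
  have BF: "\<bar>F (g r)\<bar> \<le> B" "\<bar>F (d r)\<bar> \<le> B" if "a \<le> r" for r
    using bounded[of r] a that by (simp_all add: F_def)
  have crit: "F' z = (\<lambda>_. 0)" if "z \<in> open_sector g d" "a \<le> norm z" "F' z (\<i> * z) = 0" for z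
    using free that milnor_iff sing_iff by blast
  have "\<exists>K. \<forall>z\<in>sector g d. a \<le> norm z \<longrightarrow> F z \<le> K"
    using BF neq F crit g d by (intro bounded_above_on_sector[OF \<open>0 < a\<close>, where F' = F' and B = B]) (auto simp: abs_le_iff)
  moreover have "\<exists>K. \<forall>z\<in>sector g d. a \<le> norm z \<longrightarrow> - F z \<le> K"
  proof (rule bounded_above_on_sector[OF \<open>0 < a\<close>, where F' = "\<lambda>z h. - F' z h" and B = B])
    show "((\<lambda>z. - F z) has_derivative (\<lambda>h. - F' z h)) (at z)" for z
      by (rule has_derivative_minus[OF F])
    show "(\<lambda>h. - F' z h) = (\<lambda>_. 0)" if "z \<in> open_sector g d" "a \<le> norm z" "- F' z (\<i> * z) = 0" for z
      using crit[of z] that by simp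
  qed (use BF neq g d in \<open>auto simp: abs_le_iff\<close>)
  ultimately obtain K1 K2 where "\<And>z. z \<in> sector g d \<Longrightarrow> a \<le> norm z \<Longrightarrow> F z \<le> K1 \<and> - F z \<le> K2" by blast
  then have K: "\<bar>F z\<bar> \<le> max K1 K2" if "z \<in> sector g d" "a \<le> norm z" for z
    using that by (fastforce simp: abs_le_iff le_max_iff_disj)
  have v0: "v \<noteq> 0" "v' \<noteq> 0" using dir by auto
  have narrow: False if "0 < e" "\<forall>\<^sub>F r in at_top. e \<le> Arg2pi (d r / g r)" for e
    using wide_sector_imp_constant[OF polyF K dir(1,2) that] nonconstF by blast
  show False
  proof (cases "v = v'")
    case False
    \<comment> \<open>The opening angle of the sector converges to the angle from \<open>v\<close> to \<open>v'\<close>, which is positive.\<close>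
    have "((\<lambda>r. (d r / of_real r) / (g r / of_real r)) \<longlongrightarrow> v' / v) at_top"
      by (intro tendsto_divide dir v0)
    moreover have "\<forall>\<^sub>F r in at_top. (d r / of_real r) / (g r / of_real r) = d r / g r"
      using eventually_gt_at_top[of 0] by eventually_elim simp
    ultimately have lim: "((\<lambda>r. d r / g r) \<longlongrightarrow> v' / v) at_top"
      by (rule Lim_transform_eventually)
    have pos: "0 < Arg2pi (v' / v)"
      using False Arg2pi_quotient_cis[of v' v] dir v0 Arg2pi_ge_0[of "v' / v"]
      by (cases "Arg2pi (v' / v) = 0") auto
    then have "((\<lambda>r. Arg2pi (d r / g r)) \<longlongrightarrow> Arg2pi (v' / v)) at_top"
      by (intro isCont_tendsto_compose[OF _ lim] continuous_at_Arg2pi Arg2pi_positive_imp_not_nonneg_Reals)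
    then have "\<forall>\<^sub>F r in at_top. Arg2pi (v' / v) / 2 < Arg2pi (d r / g r)"
      using pos by (intro order_tendstoD(1)) auto
    then show False
      using pos by (intro narrow[of "Arg2pi (v' / v) / 2"]) (auto elim: eventually_mono)
  next
    case True
    with differ obtain A H H' where A: "affine_chart_at A (ideal_point v)"
      and H: "tangent_to_semi_line A (ideal_point v) G H" "tangent_to_semi_line A (ideal_point v) G' H'" "H \<noteq> H'"
      by (auto simp: tangent_to_different_semi_lines_def)
    obtain u where u: "norm u = 1" "H = {affine_chart A (ideal_point v) + t *\<^sub>R u | t. t \<ge> 0}"
      "((\<lambda>q. sgn (affine_chart A q - affine_chart A (ideal_point v))) \<longlongrightarrow> u) (at (ideal_point v) within proj_embed ` G)"
      using H(1) unfolding tangent_to_semi_line_def by blast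
    obtain u' where u': "norm u' = 1" "H' = {affine_chart A (ideal_point v) + t *\<^sub>R u' | t. t \<ge> 0}"
      "((\<lambda>q. sgn (affine_chart A q - affine_chart A (ideal_point v))) \<longlongrightarrow> u') (at (ideal_point v) within proj_embed ` G')"
      using H(2) unfolding tangent_to_semi_line_def by blast
    have "u \<noteq> u'" using u u' H(3) by auto
    obtain m2 m3 k where m: "\<bar>k\<bar> = 1" "\<And>x y. x *\<^sub>R m2 + y *\<^sub>R m3 = 0 \<Longrightarrow> x = 0 \<and> y = 0"
      "\<And>a G g u. radial_section a G g \<Longrightarrow> ((\<lambda>r. g r / of_real r) \<longlongrightarrow> v) at_top \<Longrightarrow>
       ((\<lambda>q. sgn (affine_chart A q - affine_chart A (ideal_point v))) \<longlongrightarrow> u)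
         (at (ideal_point v) within proj_embed ` G) \<Longrightarrow>
       ((\<lambda>r. sgn (Im (g r / v) *\<^sub>R m2 + m3)) \<longlongrightarrow> k *\<^sub>R u) at_top"
      by (rule semi_line_tangent_slope[OF A dir(1)], rule that)
    define X Y X' Y' where "X r = Re (g r / v)" and "Y r = Im (g r / v)"
      and "X' r = Re (d r / v)" and "Y' r = Im (d r / v)" for r
    have gd: "g r = Complex (X r) (Y r) * v" "d r = Complex (X' r) (Y' r) * v" for r
      using v0 by (simp_all add: X_def Y_def X'_def Y'_def)
    have norms: "norm (Complex (X r) (Y r)) = r" "norm (Complex (X' r) (Y' r)) = r" if "a \<le> r" for r
      using g(2)[OF that] d(2)[OF that] dir(1) by (simp_all add: gd norm_mult)
    have pos: "\<forall>\<^sub>F r in at_top. 0 < Re (h r / v)" if "((\<lambda>r. h r / of_real r) \<longlongrightarrow> v) at_top" for h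
    proof -
      have "((\<lambda>r. h r / of_real r / v) \<longlongrightarrow> v / v) at_top" by (intro tendsto_divide that tendsto_const v0)
      then have "((\<lambda>r. Re (h r / of_real r / v)) \<longlongrightarrow> 1) at_top" using tendsto_Re v0 by fastforce
      then have "\<forall>\<^sub>F r in at_top. 0 < Re (h r / of_real r / v)" by (rule order_tendstoD) simp
      then show ?thesis using eventually_gt_at_top[of 0]
      proof eventually_elim
        case (elim r)
        have "h r / of_real r / v = (h r / v) / of_real r" by simp
        then have "Re (h r / of_real r / v) = Re (h r / v) / r" by (simp only: Re_divide_of_real)
        then show ?case using elim by (simp add: zero_less_divide_iff)
      qed
    qed
    have XX': "\<forall>\<^sub>F r in at_top. 0 < X r" "\<forall>\<^sub>F r in at_top. 0 < X' r"
      unfolding X_def X'_def using pos dir True by simp_all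
    obtain c1 c2 where "c1 < c2" and c:
      "(\<forall>c. c1 < c \<longrightarrow> c < c2 \<longrightarrow> (\<forall>\<^sub>F r in at_top. Y r < c \<and> c < Y' r)) \<or>
       (\<forall>c. c1 < c \<longrightarrow> c < c2 \<longrightarrow> (\<forall>\<^sub>F r in at_top. Y' r < c \<and> c < Y r))"
    proof (rule slope_tangents_separate[OF m(2)])
      show "((\<lambda>r. sgn (Y r *\<^sub>R m2 + m3)) \<longlongrightarrow> k *\<^sub>R u) at_top"
        unfolding Y_def by (rule m(3)[OF sec(1) dir(2) u(3)])
      show "((\<lambda>r. sgn (Y' r *\<^sub>R m2 + m3)) \<longlongrightarrow> k *\<^sub>R u') at_top"
        unfolding Y'_def using dir(4) True by (intro m(3)[OF sec(2) _ u'(3)]) simp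
      show "norm (k *\<^sub>R u) = 1" "norm (k *\<^sub>R u') = 1" using m(1) u u' by simp_all
      show "k *\<^sub>R u \<noteq> k *\<^sub>R u'" using m(1) \<open>u \<noteq> u'\<close> by auto
    qed blast
    from c show False
    proof
      assume between: "\<forall>c. c1 < c \<longrightarrow> c < c2 \<longrightarrow> (\<forall>\<^sub>F r in at_top. Y r < c \<and> c < Y' r)"
      \<comment> \<open>The half-line at height \<open>c\<close> is compared with the arcs on the circle through each of its points,
        whose radius \<open>norm (Complex s c)\<close> tends to infinity with \<open>s\<close>.\<close>
      have strip: "\<forall>\<^sub>F s in at_top. Complex s c * v \<in> sector g d" if "c1 < c" "c < c2" for c
      proof -
        have "\<forall>\<^sub>F r in at_top. Y r < c \<and> c < Y' r \<and> 0 < X r \<and> 0 < X' r \<and> a \<le> r"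
          using between that XX' eventually_ge_at_top[of a] by (simp add: eventually_conj_iff)
        moreover have "filterlim (\<lambda>s. norm (Complex s c)) at_top at_top"
          by (rule filterlim_at_top_mono[OF filterlim_ident])
            (use abs_Re_le_cmod[of "Complex _ c"] in \<open>auto intro!: always_eventually simp: abs_le_iff\<close>)
        ultimately have "\<forall>\<^sub>F s in at_top. Y (norm (Complex s c)) < c \<and> c < Y' (norm (Complex s c)) \<and>
            0 < X (norm (Complex s c)) \<and> 0 < X' (norm (Complex s c)) \<and> a \<le> norm (Complex s c)"
          by (rule eventually_compose_filterlim)
        then show ?thesis using eventually_gt_at_top[of 0]
        proof eventually_elim
          case (elim s)
          then show ?case
            using norms gd dir(1) v0
            by (intro heights_imp_mem_sector[of "X (norm (Complex s c))" "X' (norm (Complex s c))" s v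
                  "Y (norm (Complex s c))" "norm (Complex s c)" "Y' (norm (Complex s c))" c]) auto
        qed
      qed
      have invariant: "F (z + t *\<^sub>R v) = F z" for z t
        by (rule strip_in_sector_imp_translation_invariant[OF polyF K v0(1) \<open>c1 < c2\<close> strip])
      have "\<forall>\<^sub>F r in at_top. 0 < X r \<and> a \<le> r"
        using XX' eventually_ge_at_top[of a] by (simp add: eventually_conj_iff)
      then obtain r where r: "0 < X r" "a \<le> r"
        using eventually_happens'[OF trivial_limit_at_top_linorder] by blast
      have "G \<in> components (milnor_set f 0 - (cball 0 R \<union> sing f))"
        using succ by (simp add: immediate_successor_def milnor_arcs_def)
      then have "plane (g r) \<in> milnor_set f 0 - (cball 0 R \<union> sing f)"
        using in_components_subset g(3)[OF r(2)] by blast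
      then have "F' (g r) (\<i> * g r) = 0" "F' (g r) \<noteq> (\<lambda>_. 0)"
        using milnor_iff sing_iff by auto
      moreover have "F' (g r) = (\<lambda>_. 0)"
        using translation_invariant_imp_critical[OF F invariant v0(1) calculation(1)] r by (simp add: X_def)
      ultimately show False by simp
    next
      assume outside: "\<forall>c. c1 < c \<longrightarrow> c < c2 \<longrightarrow> (\<forall>\<^sub>F r in at_top. Y' r < c \<and> c < Y r)"
      have "\<forall>\<^sub>F r in at_top. Y' r < (c1 + c2) / 2 \<and> (c1 + c2) / 2 < Y r"
        by (rule outside[rule_format]) (use \<open>c1 < c2\<close> in simp_all)
      then have "\<forall>\<^sub>F r in at_top. pi \<le> Arg2pi (d r / g r)"
        using XX' eventually_ge_at_top[of a]
      proof eventually_elim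
        case (elim r)
        then show ?case
          unfolding gd using v0 norms[of r] by (intro heights_imp_wide_angle) auto
      qed
      then show False using narrow[OF pi_gt_zero] by blast
    qed
  qed
qed

text \<open>
  Splitting is a property of clusters at a real value, and that value is the limit of \<open>f\<close> along
  each arc of the cluster.
\<close>
lemma splits_imp_finite_limit:
  assumes "splits f R C" "cluster_of f R G C"
  obtains l :: real and c where "parametrises 0 R G c" "((\<lambda>s. ereal (f (c s))) \<longlongrightarrow> ereal l) at_top"
proof -
  obtain l :: real where "increasing_cluster f R C (ereal l) \<or> decreasing_cluster f R C (ereal l)"
    using assms(1) by (auto simp: splits_def)
  then have "increases_to f 0 R G (ereal l) \<or> decreases_to f 0 R G (ereal l)"
    using assms(2) by (auto simp: cluster_of_def increasing_cluster_def decreasing_cluster_def maximal_run_def)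
  then show ?thesis
    using that by (auto simp: increases_to_def decreases_to_def)
qed

lemma tangent_to_different_semi_lines_commute:
  "tangent_to_different_semi_lines p G G' \<Longrightarrow> tangent_to_different_semi_lines p G' G"
  unfolding tangent_to_different_semi_lines_def by blast

text \<open>
  An arc that is its own successor is excluded here: it has one point at infinity, and one
  tangent semi-line there.
\<close>
lemma immediate_successor_not_both_split:
  fixes f :: "real^2 \<Rightarrow> real"
  assumes poly: "real_polynomial_function f" and nonconst: "\<not> f constant_on UNIV" and "0 \<le> R"
    and unique: "\<exists>!p. p \<in> points_at_infinity G" "\<exists>!p. p \<in> points_at_infinity G'"
    and succ: "immediate_successor f R G G'"
    and differ: "point_at_infinity G \<noteq> point_at_infinity G' \<or>
      tangent_to_different_semi_lines (point_at_infinity G) G G'"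
    and cluster: "cluster_of f R G C" "cluster_of f R G' D"
  shows "\<not> (splits f R C \<and> splits f R D)"
proof
  assume split: "splits f R C \<and> splits f R D"
  obtain l c where "parametrises 0 R G c" "((\<lambda>s. ereal (f (c s))) \<longlongrightarrow> ereal l) at_top"
    using splits_imp_finite_limit[OF conjunct1[OF split] cluster(1)] .
  then obtain a1 g B1 where g: "radial_section a1 G g" "\<And>r. a1 \<le> r \<Longrightarrow> \<bar>f (plane (g r))\<bar> \<le> B1"
    using parametrised_arc_radial_section by blast
  obtain l' c' where "parametrises 0 R G' c'" "((\<lambda>s. ereal (f (c' s))) \<longlongrightarrow> ereal l') at_top"
    using splits_imp_finite_limit[OF conjunct2[OF split] cluster(2)] .
  then obtain a2 d B2 where d: "radial_section a2 G' d" "\<And>r. a2 \<le> r \<Longrightarrow> \<bar>f (plane (d r))\<bar> \<le> B2"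
    using parametrised_arc_radial_section by blast
  obtain v where v: "norm v = 1" "((\<lambda>r. g r / of_real r) \<longlongrightarrow> v) at_top" "point_at_infinity G = ideal_point v"
    using radial_section_direction[OF g(1) unique(1)] .
  obtain v' where v': "norm v' = 1" "((\<lambda>r. d r / of_real r) \<longlongrightarrow> v') at_top" "point_at_infinity G' = ideal_point v'"
    using radial_section_direction[OF d(1) unique(2)] .
  have "G \<noteq> G'"
    using differ tangent_semi_line_unique[OF g(1) v(1,2)] v(3) by auto
  then show False
  proof (rule bounded_consecutive_arcs_imp_False[OF poly nonconst \<open>0 \<le> R\<close> succ])
    show "radial_section (max a1 a2) G g" "radial_section (max a1 a2) G' d"
      using radial_section_mono g(1) d(1) max.cobounded1 max.cobounded2 by blast+
    show "\<bar>f (plane (g r))\<bar> \<le> max B1 B2" "\<bar>f (plane (d r))\<bar> \<le> max B1 B2" if "max a1 a2 \<le> r" for r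
      using g(2)[of r] d(2)[of r] that by auto
    show "v \<noteq> v' \<or> tangent_to_different_semi_lines (ideal_point v) G G'"
      using differ v(3) v'(3) by auto
  qed (fact v v')+
qed

theorem proposition3p16:
  fixes f :: "real^2 \<Rightarrow> real"
  assumes "real_polynomial_function f"
    and "\<not> f constant_on UNIV"
    and "0 \<in> Omega f"
  shows "\<forall>\<^sub>F R in at_top. \<forall>\<gamma>\<in>milnor_arcs f 0 R. \<forall>\<delta>\<in>milnor_arcs f 0 R. \<forall>C D.
    consecutive f R \<gamma> \<delta> \<longrightarrow>
    point_at_infinity \<gamma> \<noteq> point_at_infinity \<delta> \<or>
      (\<exists>p \<in> fibre_points_at_infinity f. point_at_infinity \<gamma> = p \<and> point_at_infinity \<delta> = p \<and>
         tangent_to_different_semi_lines p \<gamma> \<delta>) \<longrightarrow>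
    cluster_of f R \<gamma> C \<longrightarrow> cluster_of f R \<delta> D \<longrightarrow>
    \<not> (splits f R C \<and> splits f R D)"
proof -
  have "\<forall>\<^sub>F R in at_top. \<forall>G\<in>milnor_arcs f 0 R. \<exists>!p. p \<in> points_at_infinity G"
  proof -
    have "\<forall>\<^sub>F R in at_top. finite (milnor_arcs f 0 R) \<and>
        (\<forall>G\<in>milnor_arcs f 0 R. (\<exists>l. increases_to f 0 R G l \<or> decreases_to f 0 R G l) \<and>
           (\<exists>!p. p \<in> points_at_infinity G))"
      using assms(3) by (simp add: Omega_def)
    then show ?thesis by eventually_elim blast
  qed
  then show ?thesis
    using eventually_ge_at_top[of 0]
  proof eventually_elim
    case (elim R)
    note arcs = immediate_successor_not_both_split[OF assms(1,2) elim(2)]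
    show ?case
    proof (intro ballI allI impI)
      fix \<gamma> \<delta> C D
      assume G: "\<gamma> \<in> milnor_arcs f 0 R" "\<delta> \<in> milnor_arcs f 0 R"
        and consec: "consecutive f R \<gamma> \<delta>"
        and differ: "point_at_infinity \<gamma> \<noteq> point_at_infinity \<delta> \<or>
          (\<exists>p \<in> fibre_points_at_infinity f. point_at_infinity \<gamma> = p \<and> point_at_infinity \<delta> = p \<and>
             tangent_to_different_semi_lines p \<gamma> \<delta>)"
        and cluster: "cluster_of f R \<gamma> C" "cluster_of f R \<delta> D"
      have unique: "\<exists>!p. p \<in> points_at_infinity \<gamma>" "\<exists>!p. p \<in> points_at_infinity \<delta>"
        using elim G by blast+
      have differ': "point_at_infinity \<gamma> \<noteq> point_at_infinity \<delta> \<or>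
          tangent_to_different_semi_lines (point_at_infinity \<gamma>) \<gamma> \<delta>"
        using differ by blast
      then have differ'': "point_at_infinity \<delta> \<noteq> point_at_infinity \<gamma> \<or>
          tangent_to_different_semi_lines (point_at_infinity \<delta>) \<delta> \<gamma>"
        by (metis tangent_to_different_semi_lines_commute)
      from consec show "\<not> (splits f R C \<and> splits f R D)"
        unfolding consecutive_def
      proof
        assume "immediate_successor f R \<gamma> \<delta>"
        from arcs[OF unique this differ' cluster] show ?thesis .
      next
        assume "immediate_successor f R \<delta> \<gamma>"
        from arcs[OF unique(2,1) this differ'' cluster(2,1)] show ?thesis by blast
      qed
    qed
  qed
qed

end
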